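(* Let $p(z,t)$, $z\in\mathbb D$, $0\le t<T$, be such that $p(\cdot,t)$ belongs to the Carathéodory class for every $t\in[0,T)$, $p(\cdot,t)$ is $C^2$ in $\overline{\mathbb D}$ for $0\le t<T$, $p(z,\cdot)$ is continuous on $[0,T)$ for every $z\in\overline{\mathbb D}$, and $p(z,t)$, $p'(z,t)$, $p''(z,t)$ are bounded on $\overline{\mathbb D}\times[0,T)$. Let $f(z,t)$ be the solution of the Löwner–Kufarev equation $$\frac{\partial f(z,t)}{\partial t}=-z\frac{\partial f(z,t)}{\partial z}\,p(z,t),\qquad z\in\mathbb D,\ 0\le t<T,$$ with $f(z,0)=z$ (so $\Omega(0)=\mathbb D$), and put $\Omega(t)=f(\mathbb D,t)$, $\Gamma(t)=\partial\Omega(t)$. For each $t$ let $F(\cdot,\tau(t))$ be the conformal map of $\mathbb D^*=\{|z|>1\}$ onto the unbounded complementary component of $\Gamma(t)$ with $F(\infty,\tau(t))=\infty$ and expansion $F(z,\tau(t))=e^{-\tau(t)}z+b_0+b_1z^{-1}+\dots$ near $\infty$ (so $F(\mathbb T,\tau(t))=f(\mathbb T,t)=\Gamma(t)$). Let the conformal welding $\varphi=\varphi(\tilde\varphi)$ of $\Gamma(t)$ be defined by $f(e^{i\varphi},t)=F(e^{i\tilde\varphi},\tau(t))$ (both maps extended continuously to $\mathbb T$, with arguments chosen continuously so that $\varphi\to\tilde\varphi$ as $t\to0$). Then $$\varphi=\tilde\varphi+2\,\operatorname{Im} p(e^{i\tilde\varphi},0)\,t+o(t),\qquad t\to+0.$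$
   Context: $\mathbb D=\{|z|<1\}$, $\mathbb T=\partial\mathbb D$, $\mathbb D^*=\{|z|>1\}$. A function $p(\cdot,t)$ is in the Carathéodory class if it is analytic in $\mathbb D$, $p(z,t)=1+p_1(t)z+p_2(t)z^2+\dots$ and $\operatorname{Re}p(z,t)>0$ in $\mathbb D$. "$p(\cdot,t)$ is $C^2$ in $\overline{\mathbb D}$" means $p(\cdot,t)$ and its $z$-derivatives $p',p''$ extend continuously to $\overline{\mathbb D}$; primes denote derivatives in $z$. The solution $f(\cdot,t)$ maps $\mathbb D$ conformally onto $\Omega(t)\subset\mathbb D$, with $f(0,t)=0$, $f'(0,t)=e^{-t}$. *)

theory Defs
  imports "HOL-Analysis.Analysis"
begin

definition caratheodory :: "(complex \<Rightarrow> complex) \<Rightarrow> bool" where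
  "caratheodory g \<longleftrightarrow> g holomorphic_on ball 0 1 \<and> g 0 = 1 \<and> (\<forall>z\<in>ball 0 1. Re (g z) > 0)"

definition C2_closed_disc :: "(complex \<Rightarrow> complex) \<Rightarrow> bool" where
  "C2_closed_disc g \<longleftrightarrow> g holomorphic_on ball 0 1 \<and> continuous_on (cball 0 1) g \<and>
     (\<exists>g1 g2. continuous_on (cball 0 1) g1 \<and> continuous_on (cball 0 1) g2 \<and>
        (\<forall>z\<in>ball 0 1. g1 z = deriv g z \<and> g2 z = deriv (deriv g) z))"

end

theory Submission
  imports Defs "HOL-Complex_Analysis.Complex_Analysis"
begin

text \<open>
  Write \<open>f(z,t) = z e\<^bsup>q(z)\<^esup>\<close> on the unit circle and \<open>F(z,\<tau>(t)) = z exp (cnj (L z))\<close>, where \<open>L\<close> is holomorphic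
  in the \<^emph>\<open>inner\<close> disc, by reflection. A two-point maximum principle for the Loewner-Kufarev equation shows
  that \<open>f(z,t) - z\<close> has Lipschitz constant \<open>O(t)\<close> up to the boundary; hence so has \<open>q\<close>, and
  \<open>q = - t p(z,0) + o(t)\<close> uniformly on the circle.

  On the circle \<open>Re L\<close> is \<open>Re q\<close> at the welded point. So the difference \<open>\<Delta>\<close> of \<open>L\<close> under a small rotation by
  \<open>h\<close> satisfies \<open>|Re \<Delta>| \<le> O(t) |h - Im \<Delta>|\<close>, and since \<open>\<integral>(Re \<Delta>)\<^sup>2 = \<integral>(Im \<Delta>)\<^sup>2\<close> this gives
  \<open>\<integral>|\<Delta>|\<^sup>2 = O(t\<^sup>2h\<^sup>2)\<close>: the Dirichlet seminorm of \<open>L\<close> is \<open>O(t)\<close>. The real part of \<open>E = L + t p(z,0)\<close> is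
  \<open>o(t)\<close> on the circle, and therefore so is the \<open>L\<^sup>2\<close> norm of \<open>E\<close>. Carlson's inequality bounds the Taylor
  coefficients of \<open>E\<close> in \<open>l\<^sup>1\<close> by the geometric mean of its \<open>L\<^sup>2\<close> norm and its Dirichlet seminorm, so that
  \<open>E = o(t)\<close> uniformly. Comparing arguments, \<open>\<i>(\<phi> - \<phi>') = cnj L - q = t (p - cnj p) + o(t)\<close>, where \<open>\<phi>'\<close> is
  the outer angle.
\<close>

section \<open>Integrals over the unit circle\<close>

definition disc_algebra :: "(complex \<Rightarrow> complex) set" where
  "disc_algebra = {E. continuous_on (cball 0 1) E \<and> E holomorphic_on ball 0 1}"

lemma disc_algebraI:
  "continuous_on (cball 0 1) E \<Longrightarrow> E holomorphic_on ball 0 1 \<Longrightarrow> E \<in> disc_algebra"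
  by (simp add: disc_algebra_def)

lemma disc_algebra_continuous_on: "E \<in> disc_algebra \<Longrightarrow> continuous_on (cball 0 1) E"
  and disc_algebra_holomorphic_on: "E \<in> disc_algebra \<Longrightarrow> E holomorphic_on ball 0 1"
  by (simp_all add: disc_algebra_def)

lemma disc_algebra_const: "(\<lambda>z. c) \<in> disc_algebra"
  and disc_algebra_ident: "(\<lambda>z. z) \<in> disc_algebra"
  and disc_algebra_add: "E \<in> disc_algebra \<Longrightarrow> G \<in> disc_algebra \<Longrightarrow> (\<lambda>z. E z + G z) \<in> disc_algebra"
  and disc_algebra_diff: "E \<in> disc_algebra \<Longrightarrow> G \<in> disc_algebra \<Longrightarrow> (\<lambda>z. E z - G z) \<in> disc_algebra"
  and disc_algebra_mult: "E \<in> disc_algebra \<Longrightarrow> G \<in> disc_algebra \<Longrightarrow> (\<lambda>z. E z * G z) \<in> disc_algebra"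
  and disc_algebra_power: "E \<in> disc_algebra \<Longrightarrow> (\<lambda>z. E z ^ n) \<in> disc_algebra"
  by (auto simp: disc_algebra_def intro!: continuous_intros holomorphic_intros)

lemma disc_algebra_rotate:
  assumes "E \<in> disc_algebra" "cmod u = 1"
  shows "(\<lambda>z. E (u * z)) \<in> disc_algebra"
proof (rule disc_algebraI)
  show "continuous_on (cball 0 1) (\<lambda>z. E (u * z))"
    by (rule continuous_on_compose2[OF disc_algebra_continuous_on[OF assms(1)]])
       (use assms(2) in \<open>auto intro!: continuous_intros simp: norm_mult\<close>)
  show "(\<lambda>z. E (u * z)) holomorphic_on ball 0 1"
    by (rule holomorphic_on_compose_gen[OF _ disc_algebra_holomorphic_on[OF assms(1)], unfolded o_def])
       (use assms(2) in \<open>auto intro!: holomorphic_intros simp: norm_mult\<close>)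
qed

lemmas disc_algebra_intros = disc_algebra_const disc_algebra_ident disc_algebra_add disc_algebra_diff
  disc_algebra_mult disc_algebra_power disc_algebra_rotate

lemma continuous_on_cball_if_punctured:
  fixes E :: "'a::real_normed_vector \<Rightarrow> 'b::topological_space"
  assumes "0 < r" "continuous_on (cball 0 r - {0}) E" "continuous_on (ball 0 r) E"
  shows "continuous_on (cball 0 r) E"
proof -
  have "continuous_on (ball 0 r \<union> (cball 0 r - {0})) E"
  proof (rule continuous_on_Un_local_open[OF _ _ assms(3,2)])
    show "openin (top_of_set (ball 0 r \<union> (cball 0 r - {0}))) (ball 0 r)"
      unfolding openin_open by (rule exI[of _ "ball 0 r"]) auto
    show "openin (top_of_set (ball 0 r \<union> (cball 0 r - {0}))) (cball 0 r - {0})"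
      unfolding openin_open by (rule exI[of _ "-{0}"]) (use assms(1) in auto)
  qed
  moreover have "ball 0 r \<union> (cball 0 r - {0}) = cball (0::'a) r"
    using assms(1) by (auto simp: dist_norm)
  ultimately show ?thesis by simp
qed

lemma continuous_on_circle:
  "E \<in> disc_algebra \<Longrightarrow> continuous_on S (\<lambda>x. E (cis x))"
  by (rule continuous_on_compose2[OF disc_algebra_continuous_on]) (auto intro!: continuous_intros)

abbreviation circle_integral :: "(complex \<Rightarrow> real) \<Rightarrow> real" where
  "circle_integral g \<equiv> integral {0..2*pi} (\<lambda>x. g (cis x))"

lemma circle_mean_value:
  assumes "E \<in> disc_algebra"
  shows "((\<lambda>x. E (cis x)) has_integral 2 * of_real pi * E 0) {0..2*pi}"
proof -
  have "((\<lambda>u. E u / (u - 0)) has_contour_integral (2 * of_real pi * \<i> * E 0)) (part_circlepath 0 1 0 (2*pi))"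
    using Cauchy_integral_circlepath[of 0 1 E 0] assms by (simp add: circlepath_def disc_algebra_def)
  then have "((\<lambda>t. E (cis t) / cis t * \<i> * cis t) has_integral (2 * of_real pi * \<i> * E 0)) {0..2*pi}"
    by (subst (asm) has_contour_integral_part_circlepath_iff) auto
  then have "((\<lambda>t. (-\<i>) * (E (cis t) / cis t * \<i> * cis t)) has_integral
      (-\<i>) * (2 * of_real pi * \<i> * E 0)) {0..2*pi}"
    by (rule has_integral_mult_right)
  then show ?thesis
    by (simp add: field_simps)
qed

lemma integral_0_2pi_le_const:
  assumes "continuous_on {0..2*pi} g" "\<And>x. g x \<le> (c::real)"
  shows "integral {0..2*pi} g \<le> 2 * pi * c"
proof -
  have "integral {0..2*pi} g \<le> integral {0..2*pi} (\<lambda>x. c)"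
    by (intro integral_le integrable_continuous_interval assms continuous_intros)
  then show ?thesis by simp
qed

lemma circle_integral_Re_Im_diff:
  assumes "E \<in> disc_algebra"
  shows "circle_integral (\<lambda>z. (Re (E z))\<^sup>2) - circle_integral (\<lambda>z. (Im (E z))\<^sup>2) =
    2 * pi * Re ((E 0)\<^sup>2)"
proof (rule has_integral_unique)
  show "((\<lambda>x. (Re (E (cis x)))\<^sup>2 - (Im (E (cis x)))\<^sup>2) has_integral
      circle_integral (\<lambda>z. (Re (E z))\<^sup>2) - circle_integral (\<lambda>z. (Im (E z))\<^sup>2)) {0..2*pi}"
    by (intro has_integral_diff integrable_integral integrable_continuous_interval continuous_intros
        continuous_on_circle assms)
  show "((\<lambda>x. (Re (E (cis x)))\<^sup>2 - (Im (E (cis x)))\<^sup>2) has_integral 2 * pi * Re ((E 0)\<^sup>2)) {0..2*pi}"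
    using has_integral_Re[OF circle_mean_value[OF disc_algebra_power[OF assms, of 2]]]
    by (simp add: Re_power2)
qed

lemma circle_integral_norm_square:
  assumes "E \<in> disc_algebra"
  shows "circle_integral (\<lambda>z. (cmod (E z))\<^sup>2) =
    2 * circle_integral (\<lambda>z. (Re (E z))\<^sup>2) - 2 * pi * Re ((E 0)\<^sup>2)"
proof -
  have "circle_integral (\<lambda>z. (cmod (E z))\<^sup>2) =
     circle_integral (\<lambda>z. (Re (E z))\<^sup>2 + (Im (E z))\<^sup>2)"
    by (simp add: cmod_power2)
  also have "\<dots> = circle_integral (\<lambda>z. (Re (E z))\<^sup>2) + circle_integral (\<lambda>z. (Im (E z))\<^sup>2)"
    by (intro integral_add integrable_continuous_interval continuous_intros continuous_on_circle assms)
  finally show ?thesis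
    using circle_integral_Re_Im_diff[OF assms] by simp
qed

lemma circle_integral_norm_square_add_const:
  assumes "G \<in> disc_algebra"
  shows "circle_integral (\<lambda>z. (cmod (c + z * G z))\<^sup>2) =
    2 * pi * (cmod c)\<^sup>2 + circle_integral (\<lambda>z. (cmod (G z))\<^sup>2)"
proof (rule integral_unique)
  have "((\<lambda>x. cnj c * (cis x * G (cis x))) has_integral 0) {0..2*pi}"
    using circle_mean_value[of "\<lambda>z. cnj c * (z * G z)"] assms by (simp add: disc_algebra_intros)
  from has_integral_Re[OF this]
  have orthogonal: "((\<lambda>x. Re (cnj c * (cis x * G (cis x)))) has_integral 0) {0..2*pi}"
    by simp
  have const: "((\<lambda>x. (cmod c)\<^sup>2) has_integral 2 * pi * (cmod c)\<^sup>2) {0..2*pi}"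
    using has_integral_const_real[of "(cmod c)\<^sup>2" 0 "2*pi"] by simp
  have "(cmod (c + cis x * G (cis x)))\<^sup>2 =
      (cmod c)\<^sup>2 + (cmod (G (cis x)))\<^sup>2 + 2 * Re (cnj c * (cis x * G (cis x)))" for x
  proof -
    have "(cmod (c + v))\<^sup>2 = (cmod c)\<^sup>2 + (cmod v)\<^sup>2 + 2 * Re (cnj c * v)" for v
      unfolding cmod_power2 by (simp add: power2_eq_square algebra_simps)
    then show ?thesis by (simp add: norm_mult)
  qed
  moreover have "((\<lambda>x. (cmod c)\<^sup>2 + (cmod (G (cis x)))\<^sup>2 + 2 * Re (cnj c * (cis x * G (cis x)))) has_integral
      2 * pi * (cmod c)\<^sup>2 + circle_integral (\<lambda>z. (cmod (G z))\<^sup>2) + 2 * 0) {0..2*pi}"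
    by (intro has_integral_add has_integral_mult_right const orthogonal integrable_integral
        integrable_continuous_interval continuous_intros continuous_on_circle assms)
  ultimately show "((\<lambda>x. (cmod (c + cis x * G (cis x)))\<^sup>2) has_integral
      2 * pi * (cmod c)\<^sup>2 + circle_integral (\<lambda>z. (cmod (G z))\<^sup>2)) {0..2*pi}"
    by simp
qed

section \<open>Power series in the disc algebra\<close>

lemma disc_algebra_power_series:
  assumes "E \<in> disc_algebra"
  obtains a where "\<And>z. z \<in> ball 0 1 \<Longrightarrow> (\<lambda>n. a n * z ^ n) sums E z"
proof
  show "(\<lambda>n. (deriv ^^ n) E 0 / fact n * z ^ n) sums E z" if "z \<in> ball 0 1" for z
    using holomorphic_power_series[OF disc_algebra_holomorphic_on[OF assms] that] by simp
qed

lemma disc_algebra_divide_ident: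
  assumes E: "E \<in> disc_algebra" and a: "\<And>z. z \<in> ball 0 1 \<Longrightarrow> (\<lambda>n. a n * z ^ n) sums E z"
  obtains G where "G \<in> disc_algebra" "\<And>z. E z = a 0 + z * G z"
    "\<And>z. z \<in> ball 0 1 \<Longrightarrow> (\<lambda>n. a (Suc n) * z ^ n) sums G z"
proof
  define G where "G z = (if z = 0 then a 1 else (E z - a 0) / z)" for z
  have "E 0 = a 0"
    using sums_unique2[OF a[of 0] powser_sums_zero] by simp
  then show "E z = a 0 + z * G z" for z
    by (auto simp: G_def)
  show sums: "(\<lambda>n. a (Suc n) * z ^ n) sums G z" if z: "z \<in> ball 0 1" for z
  proof (cases "z = 0")
    case True
    then show ?thesis using powser_sums_zero[of "\<lambda>n. a (Suc n)"] by (simp add: G_def)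
  next
    case False
    have "(\<lambda>n. a (Suc n) * z ^ Suc n) sums (E z - a 0)"
      using a[OF z] by (subst sums_Suc_iff) simp
    from sums_divide[OF this, of z] show ?thesis
      using False by (simp add: G_def field_simps)
  qed
  show "G \<in> disc_algebra"
  proof (rule disc_algebraI)
    show hol: "G holomorphic_on ball 0 1"
      using power_series_holomorphic[of 0 1 "\<lambda>n. a (Suc n)" G] sums by simp
    have "continuous_on (cball 0 1 - {0}) (\<lambda>z. (E z - a 0) / z)"
      by (intro continuous_intros continuous_on_subset[OF disc_algebra_continuous_on[OF E]]) auto
    then have "continuous_on (cball 0 1 - {0}) G"
      by (rule continuous_on_eq) (auto simp: G_def)
    then show "continuous_on (cball 0 1) G"
      by (intro continuous_on_cball_if_punctured holomorphic_on_imp_continuous_on[OF hol]) auto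
  qed
qed

lemma Bessel_inequality_power_series:
  assumes "E \<in> disc_algebra" "\<And>z. z \<in> ball 0 1 \<Longrightarrow> (\<lambda>n. a n * z ^ n) sums E z"
  shows "2 * pi * (L2_set (\<lambda>n. cmod (a n)) {..<N})\<^sup>2 \<le> circle_integral (\<lambda>z. (cmod (E z))\<^sup>2)"
  using assms
proof (induction N arbitrary: E a)
  case 0
  then show ?case
    by (auto intro!: integral_nonneg integrable_continuous_interval continuous_intros continuous_on_circle)
next
  case (Suc N)
  obtain G where G: "G \<in> disc_algebra" "\<And>z. E z = a 0 + z * G z"
    "\<And>z. z \<in> ball 0 1 \<Longrightarrow> (\<lambda>n. a (Suc n) * z ^ n) sums G z"
    using disc_algebra_divide_ident[OF Suc.prems] by blast
  have "2 * pi * (L2_set (\<lambda>n. cmod (a n)) {..<Suc N})\<^sup>2 =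
      2 * pi * (cmod (a 0))\<^sup>2 + 2 * pi * (L2_set (\<lambda>n. cmod (a (Suc n))) {..<N})\<^sup>2"
    by (simp add: L2_set_def sum_nonneg sum.lessThan_Suc_shift algebra_simps del: sum.lessThan_Suc)
  also have "\<dots> \<le> 2 * pi * (cmod (a 0))\<^sup>2 + circle_integral (\<lambda>z. (cmod (G z))\<^sup>2)"
    using Suc.IH[OF G(1,3)] by simp
  also have "\<dots> = circle_integral (\<lambda>z. (cmod (E z))\<^sup>2)"
    unfolding G(2) by (rule circle_integral_norm_square_add_const[OF G(1), symmetric])
  finally show ?case .
qed

lemma L2_set_coeffs_le_of_Re_le:
  assumes E: "E \<in> disc_algebra" "Im (E 0) = 0" and Re_le: "\<And>z. cmod z = 1 \<Longrightarrow> \<bar>Re (E z)\<bar> \<le> \<delta>"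
    and a: "\<And>z. z \<in> ball 0 1 \<Longrightarrow> (\<lambda>n. a n * z ^ n) sums E z"
  shows "L2_set (\<lambda>n. cmod (a n)) {..<N} \<le> 2 * \<delta>"
proof (rule power2_le_imp_le)
  have "2 * pi * (L2_set (\<lambda>n. cmod (a n)) {..<N})\<^sup>2 \<le> circle_integral (\<lambda>z. (cmod (E z))\<^sup>2)"
    by (rule Bessel_inequality_power_series[OF E(1) a])
  also have "\<dots> \<le> 2 * circle_integral (\<lambda>z. (Re (E z))\<^sup>2)"
    using E(2) by (simp add: circle_integral_norm_square[OF E(1)] Re_power2)
  also have "circle_integral (\<lambda>z. (Re (E z))\<^sup>2) \<le> 2 * pi * \<delta>\<^sup>2"
  proof (rule integral_0_2pi_le_const)
    show "continuous_on {0..2*pi} (\<lambda>x. (Re (E (cis x)))\<^sup>2)"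
      by (intro continuous_intros continuous_on_circle E)
    show "(Re (E (cis x)))\<^sup>2 \<le> \<delta>\<^sup>2" for x
      using Re_le[of "cis x"] by (intro abs_le_square_iff[THEN iffD1]) auto
  qed
  finally have "(L2_set (\<lambda>n. cmod (a n)) {..<N})\<^sup>2 \<le> 2 * \<delta>\<^sup>2" by simp
  also have "\<dots> \<le> (2 * \<delta>)\<^sup>2" by (simp add: power_mult_distrib)
  finally show "(L2_set (\<lambda>n. cmod (a n)) {..<N})\<^sup>2 \<le> (2 * \<delta>)\<^sup>2" .
  show "0 \<le> 2 * \<delta>" using Re_le[of 1] by simp
qed

section \<open>Carlson's inequality\<close>

lemma arctan_diff_ge:
  assumes "0 \<le> x" "x < y"
  shows "(y - x) / (1 + y\<^sup>2) \<le> arctan y - arctan x"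
proof -
  obtain z where z: "x < z" "z < y" "arctan y - arctan x = (y - x) * inverse (1 + z\<^sup>2)"
    using MVT2[OF \<open>x < y\<close> DERIV_arctan] by blast
  have "inverse (1 + y\<^sup>2) \<le> inverse (1 + z\<^sup>2)"
    using assms z by (intro le_imp_inverse_le add_left_mono power_mono) (auto simp: add_pos_nonneg)
  then show ?thesis
    using assms z(3) by (simp add: divide_inverse mult_left_mono)
qed

lemma sum_inverse_one_plus_squares_le:
  assumes "0 < r"
  shows "(\<Sum>n=1..m. 1 / (1 + (r * real n)\<^sup>2)) \<le> pi / (2 * r)"
proof -
  have "(\<Sum>n=1..m. r / (1 + (r * real n)\<^sup>2)) \<le> arctan (r * real m)"
  proof (induction m)
    case (Suc m)
    have "r / (1 + (r * real (Suc m))\<^sup>2) \<le> arctan (r * real (Suc m)) - arctan (r * real m)"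
      using arctan_diff_ge[of "r * real m" "r * real (Suc m)"] assms by (simp add: algebra_simps)
    then show ?case using Suc by simp
  qed simp
  also have "\<dots> \<le> pi / 2"
    using arctan_ubound[of "r * real m"] by simp
  finally have "r * (\<Sum>n=1..m. 1 / (1 + (r * real n)\<^sup>2)) \<le> pi / 2"
    by (simp add: sum_distrib_left)
  then show ?thesis
    using assms by (simp add: field_simps)
qed

theorem Carlson_inequality:
  fixes a :: "nat \<Rightarrow> real"
  shows "(\<Sum>n=1..m. \<bar>a n\<bar>)\<^sup>2 \<le> pi * L2_set a {1..m} * L2_set (\<lambda>n. real n * a n) {1..m}"
proof (cases "\<forall>n\<in>{1..m}. a n = 0")
  case True
  then show ?thesis by simp
next
  case False
  define \<alpha> where "\<alpha> = L2_set a {1..m}"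
  define \<beta> where "\<beta> = L2_set (\<lambda>n. real n * a n) {1..m}"
  define r where "r = \<alpha> / \<beta>"
  have "\<alpha> \<noteq> 0" "\<beta> \<noteq> 0"
    using False by (auto simp: \<alpha>_def \<beta>_def L2_set_eq_0_iff)
  then have pos: "\<alpha> > 0" "\<beta> > 0"
    by (simp_all add: \<alpha>_def \<beta>_def less_le)
  then have "r > 0" by (simp add: r_def)
  define w where "w n = 1 + (r * real n)\<^sup>2" for n
  have w: "w n > 0" for n
    by (simp add: w_def add_pos_nonneg)
  have "(\<Sum>n=1..m. \<bar>a n\<bar>) = (\<Sum>n=1..m. \<bar>sqrt (w n) * a n\<bar> * \<bar>1 / sqrt (w n)\<bar>)"
    using w by (intro sum.cong) (auto simp: abs_mult less_imp_le less_imp_neq[THEN not_sym])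
  also have "\<dots> \<le> L2_set (\<lambda>n. sqrt (w n) * a n) {1..m} * L2_set (\<lambda>n. 1 / sqrt (w n)) {1..m}"
    by (rule L2_set_mult_ineq)
  finally have "(\<Sum>n=1..m. \<bar>a n\<bar>)\<^sup>2 \<le>
      (L2_set (\<lambda>n. sqrt (w n) * a n) {1..m})\<^sup>2 * (L2_set (\<lambda>n. 1 / sqrt (w n)) {1..m})\<^sup>2"
    by (simp only: power_mult_distrib[symmetric]) (intro power_mono sum_nonneg, auto)
  also have "(L2_set (\<lambda>n. sqrt (w n) * a n) {1..m})\<^sup>2 = \<alpha>\<^sup>2 + r\<^sup>2 * \<beta>\<^sup>2"
    using w by (simp add: L2_set_def \<alpha>_def \<beta>_def sum_nonneg power_mult_distrib less_imp_le)
      (simp add: w_def power_mult_distrib distrib_right sum.distrib sum_distrib_left mult.assoc)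
  also have "(L2_set (\<lambda>n. 1 / sqrt (w n)) {1..m})\<^sup>2 = (\<Sum>n=1..m. 1 / w n)"
    using w by (simp add: L2_set_def sum_nonneg power_divide less_imp_le)
  also have "(\<alpha>\<^sup>2 + r\<^sup>2 * \<beta>\<^sup>2) * (\<Sum>n=1..m. 1 / w n) \<le> (\<alpha>\<^sup>2 + r\<^sup>2 * \<beta>\<^sup>2) * (pi / (2 * r))"
    using sum_inverse_one_plus_squares_le[OF \<open>r > 0\<close>] unfolding w_def by (intro mult_left_mono) auto
  also have "\<dots> = pi * \<alpha> * \<beta>"
    using pos by (simp add: r_def field_simps power2_eq_square)
  finally show ?thesis by (simp add: \<alpha>_def \<beta>_def)
qed

section \<open>The Dirichlet seminorm\<close>

text \<open>By Parseval, \<open>K\<^sup>2\<close> bounds the mean of \<open>|E'|\<^sup>2\<close> over the circle.\<close>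
definition Dirichlet_bounded :: "real \<Rightarrow> (complex \<Rightarrow> complex) \<Rightarrow> bool" where
  "Dirichlet_bounded K E \<longleftrightarrow> (\<exists>a. (\<forall>z\<in>ball 0 1. (\<lambda>n. a n * z ^ n) sums E z) \<and>
     (\<forall>N. L2_set (\<lambda>n. real n * cmod (a n)) {..<N} \<le> K))"

lemma Dirichlet_bounded_add:
  assumes "Dirichlet_bounded K E" "Dirichlet_bounded K' G"
  shows "Dirichlet_bounded (K + K') (\<lambda>z. E z + G z)"
proof -
  obtain a where a: "\<And>z. z \<in> ball 0 1 \<Longrightarrow> (\<lambda>n. a n * z ^ n) sums E z"
      "\<And>N. L2_set (\<lambda>n. real n * cmod (a n)) {..<N} \<le> K"
    using assms(1) unfolding Dirichlet_bounded_def by blast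
  obtain b where b: "\<And>z. z \<in> ball 0 1 \<Longrightarrow> (\<lambda>n. b n * z ^ n) sums G z"
      "\<And>N. L2_set (\<lambda>n. real n * cmod (b n)) {..<N} \<le> K'"
    using assms(2) unfolding Dirichlet_bounded_def by blast
  have "L2_set (\<lambda>n. real n * cmod (a n + b n)) {..<N} \<le> K + K'" for N
  proof -
    have "L2_set (\<lambda>n. real n * cmod (a n + b n)) {..<N} \<le>
        L2_set (\<lambda>n. real n * cmod (a n) + real n * cmod (b n)) {..<N}"
      unfolding distrib_left[symmetric] by (intro L2_set_mono mult_left_mono norm_triangle_ineq) auto
    also have "\<dots> \<le> K + K'"
      using L2_set_triangle_ineq add_mono[OF a(2) b(2)] order_trans by blast
    finally show ?thesis .
  qed
  moreover have "(\<lambda>n. (a n + b n) * z ^ n) sums (E z + G z)" if "z \<in> ball 0 1" for z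
    using sums_add[OF a(1) b(1)] that by (simp add: distrib_right)
  ultimately show ?thesis
    unfolding Dirichlet_bounded_def by (intro exI[of _ "\<lambda>n. a n + b n"]) simp
qed

lemma Dirichlet_bounded_cmult:
  assumes "Dirichlet_bounded K E"
  shows "Dirichlet_bounded (cmod c * K) (\<lambda>z. c * E z)"
proof -
  obtain a where a: "\<And>z. z \<in> ball 0 1 \<Longrightarrow> (\<lambda>n. a n * z ^ n) sums E z"
      "\<And>N. L2_set (\<lambda>n. real n * cmod (a n)) {..<N} \<le> K"
    using assms unfolding Dirichlet_bounded_def by blast
  have "L2_set (\<lambda>n. real n * cmod (c * a n)) {..<N} = cmod c * L2_set (\<lambda>n. real n * cmod (a n)) {..<N}" for N
    by (simp add: L2_set_right_distrib norm_mult mult.left_commute)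
  then have "L2_set (\<lambda>n. real n * cmod (c * a n)) {..<N} \<le> cmod c * K" for N
    using a(2) by (simp add: mult_left_mono)
  moreover have "(\<lambda>n. (c * a n) * z ^ n) sums (c * E z)" if "z \<in> ball 0 1" for z
    using sums_mult[OF a(1)] that by (simp add: mult.assoc)
  ultimately show ?thesis
    unfolding Dirichlet_bounded_def by (intro exI[of _ "\<lambda>n. c * a n"]) simp
qed

lemma norm_cis_diff_le: "cmod (cis x - cis y) \<le> \<bar>x - y\<bar>"
proof -
  have "cis x - cis y = cis y * (exp (\<i> * of_real (x - y)) - 1)"
    by (simp add: algebra_simps cis_mult flip: cis_conv_exp del: of_real_diff)
  then have "cmod (cis x - cis y) = 2 * \<bar>sin ((x - y) / 2)\<bar>"
    by (simp add: norm_mult dist_exp_i_1 del: of_real_diff)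
  then show ?thesis using abs_sin_x_le_abs_x[of "(x - y) / 2"] by simp
qed

lemma cis_difference_quotient: "((\<lambda>h. cmod (cis (real n * h) - 1) / h) \<longlongrightarrow> real n) (at_right 0)"
proof -
  have "((\<lambda>h::complex. exp (\<i> * of_nat n * h)) has_field_derivative \<i> * of_nat n) (at 0)"
    by (auto intro!: derivative_eq_intros)
  then have "((\<lambda>h::complex. (exp (\<i> * of_nat n * h) - 1) / h) \<longlongrightarrow> \<i> * of_nat n) (at 0)"
    by (simp add: has_field_derivative_iff)
  moreover have "filterlim (\<lambda>h. of_real h :: complex) (at 0) (at_right 0)"
    by (auto simp: filterlim_at eventually_at_filter intro!: tendsto_eq_intros)
  ultimately have "((\<lambda>h. (exp (\<i> * of_nat n * of_real h) - 1) / of_real h) \<longlongrightarrow> \<i> * of_nat n) (at_right 0)"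
    by (rule filterlim_compose)
  from tendsto_norm[OF this] have "((\<lambda>h. cmod (cis (real n * h) - 1) / \<bar>h\<bar>) \<longlongrightarrow> real n) (at_right 0)"
    by (simp add: cis_conv_exp norm_divide norm_mult mult.assoc)
  moreover have "\<forall>\<^sub>F h in at_right 0. cmod (cis (real n * h) - 1) / \<bar>h\<bar> = cmod (cis (real n * h) - 1) / h"
    by (auto simp: eventually_at_filter)
  ultimately show ?thesis
    by (rule Lim_transform_eventually)
qed

lemma Dirichlet_boundedI_rotation:
  assumes E: "E \<in> disc_algebra" and "0 \<le> K"
    and bound: "\<forall>\<^sub>F h in at_right 0.
      circle_integral (\<lambda>z. (cmod (E (cis h * z) - E z))\<^sup>2) \<le> 2 * pi * (K * h)\<^sup>2"
  shows "Dirichlet_bounded K E"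
proof -
  obtain a where a: "\<And>z. z \<in> ball 0 1 \<Longrightarrow> (\<lambda>n. a n * z ^ n) sums E z"
    using disc_algebra_power_series[OF E] by blast
  have "L2_set (\<lambda>n. real n * cmod (a n)) {..<N} \<le> K" for N
  proof (rule tendsto_upperbound)
    show "((\<lambda>h. L2_set (\<lambda>n. cmod (cis (real n * h) - 1) / h * cmod (a n)) {..<N}) \<longlongrightarrow>
        L2_set (\<lambda>n. real n * cmod (a n)) {..<N}) (at_right 0)"
      unfolding L2_set_def by (intro tendsto_intros cis_difference_quotient)
    show "\<forall>\<^sub>F h in at_right 0. L2_set (\<lambda>n. cmod (cis (real n * h) - 1) / h * cmod (a n)) {..<N} \<le> K"
      using bound eventually_at_right_less[of 0]
    proof eventually_elim
      case (elim h)
      have "2 * pi * (L2_set (\<lambda>n. cmod (a n * (cis (real n * h) - 1))) {..<N})\<^sup>2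
          \<le> circle_integral (\<lambda>z. (cmod (E (cis h * z) - E z))\<^sup>2)"
      proof (rule Bessel_inequality_power_series[where E = "\<lambda>z. E (cis h * z) - E z"])
        show "(\<lambda>z. E (cis h * z) - E z) \<in> disc_algebra"
          by (intro disc_algebra_intros E) simp
        show "(\<lambda>n. a n * (cis (real n * h) - 1) * z ^ n) sums (E (cis h * z) - E z)" if "z \<in> ball 0 1" for z
          using sums_diff[OF a[of "cis h * z"] a[of z]] that
          by (simp add: norm_mult power_mult_distrib Complex.DeMoivre right_diff_distrib left_diff_distrib
              mult.assoc)
      qed
      also note elim(1)
      finally have "(L2_set (\<lambda>n. cmod (a n * (cis (real n * h) - 1))) {..<N})\<^sup>2 \<le> (K * h)\<^sup>2"
        by simp
      then have "L2_set (\<lambda>n. cmod (a n * (cis (real n * h) - 1))) {..<N} \<le> K * h"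
        by (rule power2_le_imp_le) (use elim(2) \<open>0 \<le> K\<close> in simp)
      moreover have "L2_set (\<lambda>n. cmod (cis (real n * h) - 1) / h * cmod (a n)) {..<N} =
          (1 / h) * L2_set (\<lambda>n. cmod (a n * (cis (real n * h) - 1))) {..<N}"
        using elim(2) by (subst L2_set_right_distrib) (auto simp: norm_mult mult_ac)
      ultimately show ?case
        using elim(2) by (simp add: pos_divide_le_eq)
    qed
  qed simp
  with a show ?thesis
    unfolding Dirichlet_bounded_def by blast
qed

lemma norm_le_of_L2_set_coeffs_le:
  assumes E: "E \<in> disc_algebra" and a: "\<And>z. z \<in> ball 0 1 \<Longrightarrow> (\<lambda>n. a n * z ^ n) sums E z"
    and S: "\<And>N. L2_set (\<lambda>n. cmod (a n)) {..<N} \<le> S"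
    and K: "\<And>N. L2_set (\<lambda>n. real n * cmod (a n)) {..<N} \<le> K"
    and z: "z \<in> cball 0 1"
  shows "cmod (E z) \<le> S + sqrt (pi * S * K)"
proof -
  have L2_le: "L2_set g {1..m} \<le> C" if "\<And>N. L2_set g {..<N} \<le> C" for g C and m :: nat
  proof -
    have "L2_set g {1..m} \<le> L2_set g {..<Suc m}"
      unfolding L2_set_def by (intro real_sqrt_le_mono sum_mono2) auto
    then show ?thesis using that order_trans by blast
  qed
  have sum_le: "(\<Sum>n<m. cmod (a n)) \<le> S + sqrt (pi * S * K)" for m
  proof -
    have "(\<Sum>n=1..m. \<bar>cmod (a n)\<bar>)\<^sup>2 \<le>
        pi * L2_set (\<lambda>n. cmod (a n)) {1..m} * L2_set (\<lambda>n. real n * cmod (a n)) {1..m}"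
      by (rule Carlson_inequality)
    also have "\<dots> \<le> pi * S * K"
      using S[of 0] by (intro mult_mono L2_le S K) auto
    finally have tail: "(\<Sum>n=1..m. cmod (a n)) \<le> sqrt (pi * S * K)"
      by (simp add: real_le_rsqrt)
    have "(\<Sum>n<m. cmod (a n)) \<le> (\<Sum>n\<in>insert 0 {1..m}. cmod (a n))"
      by (intro sum_mono2) auto
    also have "\<dots> = cmod (a 0) + (\<Sum>n=1..m. cmod (a n))"
      by simp
    also have "cmod (a 0) \<le> S"
      using S[of 1] by (simp add: lessThan_Suc)
    finally show ?thesis using tail by simp
  qed
  have interior: "cmod (E w) \<le> S + sqrt (pi * S * K)" if w: "w \<in> ball 0 1" for w
  proof (rule Lim_bounded)
    show "(\<lambda>m. cmod (\<Sum>n<m. a n * w ^ n)) \<longlonglongrightarrow> cmod (E w)"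
      using a[OF w] by (intro tendsto_norm) (simp add: sums_def)
    have "cmod (\<Sum>n<m. a n * w ^ n) \<le> (\<Sum>n<m. cmod (a n))" for m
      using w by (intro sum_norm_le) (simp add: norm_mult norm_power mult_left_le power_le_one)
    then show "\<forall>m\<ge>0. cmod (\<Sum>n<m. a n * w ^ n) \<le> S + sqrt (pi * S * K)"
      using sum_le order_trans by blast
  qed
  show ?thesis
    by (rule continuous_on_closure_norm_le[of "ball 0 1" E])
       (use disc_algebra_continuous_on[OF E] interior z in auto)
qed

lemma norm_le_of_Re_le_Dirichlet_bounded:
  assumes E: "E \<in> disc_algebra" "Im (E 0) = 0" and Re_le: "\<And>z. cmod z = 1 \<Longrightarrow> \<bar>Re (E z)\<bar> \<le> \<delta>"
    and K: "Dirichlet_bounded K E" and z: "z \<in> cball 0 1"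
  shows "cmod (E z) \<le> 2 * \<delta> + sqrt (2 * pi * \<delta> * K)"
proof -
  obtain a where a: "\<And>z. z \<in> ball 0 1 \<Longrightarrow> (\<lambda>n. a n * z ^ n) sums E z"
      "\<And>N. L2_set (\<lambda>n. real n * cmod (a n)) {..<N} \<le> K"
    using K unfolding Dirichlet_bounded_def by blast
  have "L2_set (\<lambda>n. cmod (a n)) {..<N} \<le> 2 * \<delta>" for N
    by (rule L2_set_coeffs_le_of_Re_le[OF E Re_le a(1)])
  from norm_le_of_L2_set_coeffs_le[OF E(1) a(1) this a(2) z] show ?thesis
    by (simp add: mult_ac)
qed

lemma Dirichlet_bounded_lipschitz:
  assumes E: "E \<in> disc_algebra" and lip: "K-lipschitz_on (sphere 0 1) E"
  shows "Dirichlet_bounded K E"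
proof (rule Dirichlet_boundedI_rotation[OF E lipschitz_on_nonneg[OF lip]])
  have "circle_integral (\<lambda>z. (cmod (E (cis h * z) - E z))\<^sup>2) \<le> 2 * pi * (K * h)\<^sup>2" for h
  proof (rule integral_0_2pi_le_const)
    show "continuous_on {0..2*pi} (\<lambda>x. (cmod (E (cis h * cis x) - E (cis x)))\<^sup>2)"
      by (intro continuous_intros continuous_on_circle[where E = "\<lambda>z. E (cis h * z) - E z"]
          disc_algebra_intros E) simp
    fix x
    have "cmod (E (cis h * cis x) - E (cis x)) \<le> K * cmod (cis (h + x) - cis x)"
      using lipschitz_on_normD[OF lip, of "cis h * cis x" "cis x"] by (simp add: cis_mult)
    also have "\<dots> \<le> \<bar>K * h\<bar>"
      using norm_cis_diff_le[of "h + x" x] lipschitz_on_nonneg[OF lip] by (simp add: abs_mult mult_left_mono)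
    finally show "(cmod (E (cis h * cis x) - E (cis x)))\<^sup>2 \<le> (K * h)\<^sup>2"
      by (intro abs_le_square_iff[THEN iffD1]) simp
  qed
  then show "\<forall>\<^sub>F h in at_right 0.
      circle_integral (\<lambda>z. (cmod (E (cis h * z) - E z))\<^sup>2) \<le> 2 * pi * (K * h)\<^sup>2"
    by simp
qed

section \<open>Welding of two perturbed circles\<close>

lemma circle_integral_norm_square_le_of_Re_le:
  assumes G: "G \<in> disc_algebra" "G 0 = 0" and "0 \<le> \<epsilon>" "\<epsilon> \<le> 1/4"
    and Re_le: "\<And>x. \<bar>Re (G (cis x))\<bar> \<le> 2 * \<epsilon> * \<bar>h - Im (G (cis x))\<bar>"
  shows "circle_integral (\<lambda>z. (cmod (G z))\<^sup>2) \<le> 2 * pi * (4 * \<epsilon> * h)\<^sup>2"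
proof -
  define X where "X = circle_integral (\<lambda>z. (Re (G z))\<^sup>2)"
  have cont: "continuous_on {0..2*pi} (\<lambda>x. G (cis x))"
    by (rule continuous_on_circle[OF G(1)])
  have "0 \<le> X"
    unfolding X_def by (intro integral_nonneg integrable_continuous_interval continuous_intros cont) auto
  have Im_square: "circle_integral (\<lambda>z. (Im (G z))\<^sup>2) = X"
    using circle_integral_Re_Im_diff[OF G(1)] G(2) by (simp add: X_def)
  have Im_mean: "circle_integral (\<lambda>z. Im (G z)) = 0"
    using has_integral_Im[OF circle_mean_value[OF G(1)]] G(2) by (simp add: integral_unique)
  have const: "((\<lambda>x. h\<^sup>2) has_integral 2 * pi * h\<^sup>2) {0..2*pi}"
    using has_integral_const_real[of "h\<^sup>2" 0 "2*pi"] by simp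
  have "((\<lambda>x. h\<^sup>2 - 2 * h * Im (G (cis x)) + (Im (G (cis x)))\<^sup>2) has_integral
      2 * pi * h\<^sup>2 - 2 * h * circle_integral (\<lambda>z. Im (G z)) + X) {0..2*pi}"
    unfolding Im_square[symmetric]
    by (intro has_integral_add has_integral_diff has_integral_mult_right const integrable_integral
        integrable_continuous_interval continuous_intros cont)
  then have "((\<lambda>x. (h - Im (G (cis x)))\<^sup>2) has_integral 2 * pi * h\<^sup>2 + X) {0..2*pi}"
    unfolding Im_mean by (simp add: power2_diff algebra_simps)
  then have "((\<lambda>x. (2 * \<epsilon>)\<^sup>2 * (h - Im (G (cis x)))\<^sup>2) has_integral (2 * \<epsilon>)\<^sup>2 * (2 * pi * h\<^sup>2 + X)) {0..2*pi}"
    by (rule has_integral_mult_right)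
  moreover have "(Re (G (cis x)))\<^sup>2 \<le> (2 * \<epsilon>)\<^sup>2 * (h - Im (G (cis x)))\<^sup>2" for x
    unfolding power_mult_distrib[symmetric]
    by (rule abs_le_square_iff[THEN iffD1]) (use Re_le[of x] \<open>0 \<le> \<epsilon>\<close> in \<open>simp add: abs_mult\<close>)
  ultimately have "X \<le> (2 * \<epsilon>)\<^sup>2 * (2 * pi * h\<^sup>2 + X)"
    unfolding X_def
    by (intro has_integral_le[OF integrable_integral])
       (auto intro!: integrable_continuous_interval continuous_intros cont)
  moreover have "(2 * \<epsilon>)\<^sup>2 * X \<le> 1/4 * X"
    using power_mono[of "2 * \<epsilon>" "1/2" 2] assms(3,4) \<open>0 \<le> X\<close> by (intro mult_right_mono) (auto simp: power_divide)
  ultimately have "X \<le> 2 * ((2 * \<epsilon>)\<^sup>2 * (2 * pi * h\<^sup>2))"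
    using \<open>0 \<le> X\<close> by (simp add: distrib_left)
  moreover have "circle_integral (\<lambda>z. (cmod (G z))\<^sup>2) = 2 * X"
    using circle_integral_norm_square[OF G(1)] G(2) by (simp add: X_def)
  ultimately show ?thesis
    by (simp add: power_mult_distrib mult_ac)
qed

lemma cis_mult_exp_inject:
  assumes "cis x * exp a = cis y * exp b" "\<bar>(x + Im a) - (y + Im b)\<bar> < 2 * pi"
  shows "\<i> * of_real x + a = \<i> * of_real y + b"
proof (rule exp_complex_eqI)
  show "exp (\<i> * of_real x + a) = exp (\<i> * of_real y + b)"
    using assms(1) by (simp add: cis_conv_exp exp_add)
qed (use assms(2) in simp)

lemma abs_Re_le_of_unit_mult_exp_eq:
  assumes u: "cmod u = 1" and eq: "u * exp d = cis h * exp e"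
    and d: "cmod d \<le> \<epsilon> * cmod (u - 1)" and \<epsilon>: "0 \<le> \<epsilon>" "\<epsilon> \<le> 1/2" and small: "\<bar>h + Im e\<bar> \<le> 1"
  shows "\<bar>Re e\<bar> \<le> 2 * \<epsilon> * \<bar>h + Im e\<bar>"
proof -
  define \<phi> where "\<phi> = Arg u"
  have "u \<noteq> 0" using u by auto
  then have \<phi>: "u = cis \<phi>" "\<bar>\<phi>\<bar> \<le> pi"
    using cis_Arg[of u] u Arg_bounded[of u] by (auto simp: \<phi>_def sgn_eq)
  have "cmod (u - 1) \<le> \<bar>\<phi>\<bar>"
    using norm_cis_diff_le[of \<phi> 0] by (simp add: \<phi>(1))
  then have "cmod d \<le> \<epsilon> * \<bar>\<phi>\<bar>"
    using d mult_left_mono[OF _ \<epsilon>(1)] by (meson order_trans)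
  moreover have "\<epsilon> * \<bar>\<phi>\<bar> \<le> 1/2 * \<bar>\<phi>\<bar>"
    using \<epsilon> by (intro mult_right_mono) auto
  ultimately have half: "cmod d \<le> 1/2 * \<bar>\<phi>\<bar>"
    by (rule order_trans)
  then have "\<bar>(\<phi> + Im d) - (h + Im e)\<bar> < 2 * pi"
    using abs_Im_le_cmod[of d] small \<phi>(2) pi_gt3 by linarith
  with eq have "\<i> * of_real \<phi> + d = \<i> * of_real h + e"
    unfolding \<phi>(1) by (rule cis_mult_exp_inject)
  then have "\<phi> + Im d = h + Im e" "Re d = Re e"
    by (simp_all add: complex_eq_iff)
  then have "\<bar>\<phi>\<bar> \<le> \<bar>h + Im e\<bar> + \<bar>Im d\<bar>"
    by linarith
  then have "\<bar>\<phi>\<bar> \<le> 2 * \<bar>h + Im e\<bar>"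
    using half abs_Im_le_cmod[of d] by argo
  then have "\<epsilon> * \<bar>\<phi>\<bar> \<le> \<epsilon> * (2 * \<bar>h + Im e\<bar>)"
    using \<epsilon>(1) by (rule mult_left_mono)
  then show ?thesis
    using \<open>cmod d \<le> \<epsilon> * \<bar>\<phi>\<bar>\<close> \<open>Re d = Re e\<close> abs_Re_le_cmod[of d] by simp
qed

text \<open>
  The curve is \<open>w exp (q w)\<close> seen from inside and \<open>z exp (cnj (L z))\<close> seen from outside. The conjugate turns the
  exterior logarithm into a function of the disc algebra.
\<close>
locale welding =
  fixes q L :: "complex \<Rightarrow> complex" and \<epsilon> :: real
  assumes L_disc_algebra: "L \<in> disc_algebra"
    and Im_L_0: "Im (L 0) = 0"
    and q_lipschitz: "\<epsilon>-lipschitz_on (sphere 0 1) q"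
    and norm_q_le: "cmod w = 1 \<Longrightarrow> cmod (q w) \<le> \<epsilon>"
    and \<epsilon>_le: "\<epsilon> \<le> 1/32"
    and welded: "cmod z = 1 \<Longrightarrow> \<exists>w. cmod w = 1 \<and> w * exp (q w) = z * exp (cnj (L z))"
begin

lemma \<epsilon>_nonneg: "0 \<le> \<epsilon>"
  by (rule lipschitz_on_nonneg[OF q_lipschitz])

lemma Re_rotation_difference_le:
  assumes "cmod z = 1" "\<bar>h\<bar> \<le> 1/2" "cmod (L (cis h * z) - L z) \<le> 1/2"
  shows "\<bar>Re (L (cis h * z) - L z)\<bar> \<le> 2 * \<epsilon> * \<bar>h - Im (L (cis h * z) - L z)\<bar>"
proof -
  obtain w where w: "cmod w = 1" "w * exp (q w) = z * exp (cnj (L z))"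
    using welded assms(1) by blast
  obtain v where v: "cmod v = 1" "v * exp (q v) = cis h * z * exp (cnj (L (cis h * z)))"
    using welded[of "cis h * z"] assms(1) by (auto simp: norm_mult)
  define u where "u = v / w"
  have nonzero: "w \<noteq> 0" "z \<noteq> 0" using w(1) assms(1) by auto
  have "u * exp (q v - q w) = (v * exp (q v)) / (w * exp (q w))"
    by (simp add: u_def exp_diff)
  also have "\<dots> = cis h * exp (cnj (L (cis h * z) - L z))"
    unfolding v(2) w(2) using nonzero by (simp add: exp_diff)
  finally have eq: "u * exp (q v - q w) = cis h * exp (cnj (L (cis h * z) - L z))" .
  have "u - 1 = (v - w) / w"
    using nonzero by (simp add: u_def field_simps)
  then have "cmod (q v - q w) \<le> \<epsilon> * cmod (u - 1)"
    using lipschitz_on_normD[OF q_lipschitz, of v w] v(1) w(1) by (simp add: norm_divide)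
  moreover have "\<bar>h + Im (cnj (L (cis h * z) - L z))\<bar> \<le> 1"
    using assms(2,3) abs_Im_le_cmod[of "L (cis h * z) - L z"] by simp
  ultimately have "\<bar>Re (cnj (L (cis h * z) - L z))\<bar> \<le> 2 * \<epsilon> * \<bar>h + Im (cnj (L (cis h * z) - L z))\<bar>"
    by (intro abs_Re_le_of_unit_mult_exp_eq[OF _ eq])
       (use v(1) w(1) \<epsilon>_nonneg \<epsilon>_le in \<open>auto simp: u_def norm_divide\<close>)
  then show ?thesis by (simp add: algebra_simps)
qed

lemma Dirichlet_bounded_L: "Dirichlet_bounded (4 * \<epsilon>) L"
proof (rule Dirichlet_boundedI_rotation[OF L_disc_algebra])
  show "0 \<le> 4 * \<epsilon>" using \<epsilon>_nonneg by simp
  have "uniformly_continuous_on (cball 0 1) L"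
    by (intro compact_uniformly_continuous disc_algebra_continuous_on L_disc_algebra) auto
  moreover have "(0::real) < 1/2" by simp
  ultimately obtain d where d: "d > 0"
    "\<And>x y. x \<in> cball 0 1 \<Longrightarrow> y \<in> cball 0 1 \<Longrightarrow> dist x y < d \<Longrightarrow> dist (L x) (L y) < 1/2"
    unfolding uniformly_continuous_on_def by metis
  have "\<forall>\<^sub>F h in at_right 0. 0 < h \<and> h < min d (1/2 :: real)"
    using d(1) by (intro eventually_conj eventually_at_right_less eventually_at_rightI[of 0 "min d (1/2)"]) auto
  then show "\<forall>\<^sub>F h in at_right 0.
      circle_integral (\<lambda>z. (cmod (L (cis h * z) - L z))\<^sup>2) \<le> 2 * pi * (4 * \<epsilon> * h)\<^sup>2"
  proof eventually_elim
    case (elim h)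
    show ?case
    proof (rule circle_integral_norm_square_le_of_Re_le[where G = "\<lambda>z. L (cis h * z) - L z"])
      show "(\<lambda>z. L (cis h * z) - L z) \<in> disc_algebra"
        by (intro disc_algebra_intros L_disc_algebra) simp
      fix x
      have "dist (cis h * cis x) (cis x) < d"
        using norm_cis_diff_le[of "h + x" x] elim by (simp add: dist_norm cis_mult)
      then have "dist (L (cis h * cis x)) (L (cis x)) < 1/2"
        by (intro d) (auto simp: norm_mult)
      then show "\<bar>Re (L (cis h * cis x) - L (cis x))\<bar> \<le> 2 * \<epsilon> * \<bar>h - Im (L (cis h * cis x) - L (cis x))\<bar>"
        using elim by (intro Re_rotation_difference_le) (auto simp: dist_norm)
    qed (use \<epsilon>_nonneg \<epsilon>_le in auto)
  qed
qed

lemma Re_L_eq_Re_q: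
  assumes "cmod z = 1" "cmod w = 1" "w * exp (q w) = z * exp (cnj (L z))"
  shows "Re (L z) = Re (q w)"
  using arg_cong[OF assms(3), of cmod] assms(1,2) by (simp add: norm_mult norm_exp_eq_Re)

lemma norm_L_le:
  assumes "z \<in> cball 0 1"
  shows "cmod (L z) \<le> 8 * \<epsilon>"
proof -
  have "\<bar>Re (L z)\<bar> \<le> \<epsilon>" if z: "cmod z = 1" for z
  proof -
    obtain w where "cmod w = 1" "w * exp (q w) = z * exp (cnj (L z))"
      using welded z by blast
    then show ?thesis
      using Re_L_eq_Re_q[OF z] norm_q_le[of w] abs_Re_le_cmod[of "q w"] by simp
  qed
  from norm_le_of_Re_le_Dirichlet_bounded[OF L_disc_algebra Im_L_0 this Dirichlet_bounded_L assms]
  have "cmod (L z) \<le> 2 * \<epsilon> + sqrt (2 * pi * \<epsilon> * (4 * \<epsilon>))" .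
  also have "2 * pi * \<epsilon> * (4 * \<epsilon>) = (8 * pi) * \<epsilon>\<^sup>2"
    by (simp add: power2_eq_square)
  also have "sqrt ((8 * pi) * \<epsilon>\<^sup>2) \<le> sqrt (6\<^sup>2 * \<epsilon>\<^sup>2)"
    using pi_less_4 by (intro real_sqrt_le_mono mult_right_mono) auto
  also have "\<dots> = 6 * \<epsilon>"
    using \<epsilon>_nonneg by (simp add: real_sqrt_mult)
  finally show ?thesis by simp
qed

lemma welded_close:
  assumes z: "cmod z = 1"
  obtains w where "cmod w = 1" "Re (L z) = Re (q w)" "cmod (z - w) \<le> 14 * \<epsilon>"
proof -
  obtain w where w: "cmod w = 1" "w * exp (q w) = z * exp (cnj (L z))"
    using welded z by blast
  have log_le: "cmod (cnj (L z) - q w) \<le> 9 * \<epsilon>"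
    using norm_triangle_ineq4[of "cnj (L z)" "q w"] norm_L_le[of z] norm_q_le[OF w(1)] z by simp
  have "w = z * exp (cnj (L z) - q w)"
    using w(2) by (simp add: exp_diff field_simps)
  then have "w - z = z * (exp (cnj (L z) - q w) - 1)"
    by (simp add: algebra_simps)
  then have "cmod (z - w) = cmod (exp (cnj (L z) - q w) - 1)"
    using z by (metis mult_1 norm_minus_commute norm_mult)
  also have "\<dots> \<le> 3 / 2 * cmod (cnj (L z) - q w)"
    using log_le \<epsilon>_le by (intro norm_exp_bounds) simp
  also have "\<dots> \<le> 14 * \<epsilon>"
    using log_le \<epsilon>_nonneg by simp
  finally show ?thesis
    using that w Re_L_eq_Re_q[OF z] by blast
qed

lemma norm_L_diff_le:
  assumes Q: "Q \<in> disc_algebra" "Im (Q 0) = 0" "M-lipschitz_on (cball 0 1) Q" and t: "0 \<le> t"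
    and q_near: "\<And>w. cmod w = 1 \<Longrightarrow> cmod (q w - of_real t * Q w) \<le> \<delta> - 14 * t * M * \<epsilon>"
    and z: "z \<in> cball 0 1"
  shows "cmod (L z - of_real t * Q z) \<le> 2 * \<delta> + sqrt (2 * pi * \<delta> * (4 * \<epsilon> + t * M))"
proof -
  let ?E = "\<lambda>z. L z + (- of_real t) * Q z"
  have "M \<ge> 0" by (rule lipschitz_on_nonneg[OF Q(3)])
  have Re_le: "\<bar>Re (?E z)\<bar> \<le> \<delta>" if z: "cmod z = 1" for z
  proof -
    obtain w where w: "cmod w = 1" "Re (L z) = Re (q w)" "cmod (z - w) \<le> 14 * \<epsilon>"
      using welded_close[OF z] by blast
    have "cmod (Q w - Q z) \<le> M * cmod (z - w)"
      using lipschitz_on_normD[OF Q(3), of w z] z w(1) by (simp add: norm_minus_commute)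
    also have "\<dots> \<le> M * (14 * \<epsilon>)"
      using w(3) \<open>M \<ge> 0\<close> by (rule mult_left_mono)
    finally have "cmod (of_real t * (Q w - Q z)) \<le> 14 * t * M * \<epsilon>"
      using t mult_left_mono[of _ _ t] by (fastforce simp: norm_mult mult_ac)
    then have "cmod ((q w - of_real t * Q w) + of_real t * (Q w - Q z)) \<le> \<delta>"
      using q_near[OF w(1)] norm_triangle_ineq[of "q w - of_real t * Q w" "of_real t * (Q w - Q z)"] by linarith
    moreover have "Re (?E z) = Re ((q w - of_real t * Q w) + of_real t * (Q w - Q z))"
      using w(2) by (simp add: algebra_simps)
    ultimately show ?thesis
      using abs_Re_le_cmod order_trans by metis
  qed
  have "Dirichlet_bounded M Q"
    by (intro Dirichlet_bounded_lipschitz Q lipschitz_on_subset[OF Q(3)]) auto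
  from Dirichlet_bounded_cmult[OF this, of "- of_real t"]
  have "Dirichlet_bounded (t * M) (\<lambda>z. - of_real t * Q z)"
    using t by simp
  from norm_le_of_Re_le_Dirichlet_bounded[OF _ _ Re_le Dirichlet_bounded_add[OF Dirichlet_bounded_L this] z]
  show ?thesis
    using L_disc_algebra Im_L_0 Q(1,2) by (simp add: disc_algebra_intros)
qed

lemma angle_diff_eq:
  assumes eq: "cis \<psi> * exp (q (cis \<psi>)) = cis \<theta> * exp (cnj (L (cis \<theta>)))" and near: "\<bar>\<psi> - \<theta>\<bar> \<le> 1"
  shows "\<psi> - \<theta> = Im (cnj (L (cis \<theta>)) - q (cis \<psi>))"
proof -
  have "\<bar>Im (q (cis \<psi>))\<bar> \<le> 1" "\<bar>Im (L (cis \<theta>))\<bar> \<le> 1"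
    using norm_q_le[of "cis \<psi>"] norm_L_le[of "cis \<theta>"] \<epsilon>_le abs_Im_le_cmod[of "q (cis \<psi>)"]
      abs_Im_le_cmod[of "L (cis \<theta>)"] by simp_all
  then have "\<bar>(\<psi> + Im (q (cis \<psi>))) - (\<theta> + Im (cnj (L (cis \<theta>))))\<bar> < 2 * pi"
    using near pi_gt3 by simp
  from cis_mult_exp_inject[OF eq this] show ?thesis
    by (simp add: complex_eq_iff)
qed

end

section \<open>Welding to first order\<close>

lemma eventually_at_right_0_mult_less:
  fixes c :: real
  assumes "0 < e"
  shows "\<forall>\<^sub>F t in at_right 0. c * t < e"
proof -
  have "((\<lambda>t. c * t) \<longlongrightarrow> c * 0) (at_right 0)"
    by (intro tendsto_intros)
  then show ?thesis
    using assms by (intro order_tendstoD(2)) auto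
qed

lemma dist_divide_of_real:
  fixes x y :: complex
  assumes "0 < t"
  shows "dist (x / of_real t) y = cmod (x - of_real t * y) / t"
proof -
  have "x / of_real t - y = (x - of_real t * y) / of_real t"
    using assms by (simp add: field_simps)
  then show ?thesis
    using assms by (simp add: dist_norm norm_divide)
qed

lemma uniform_limit_tendsto_compose:
  assumes lim: "uniform_limit S f l F" and l: "continuous_on S l"
    and g: "(g \<longlongrightarrow> x) F" "\<forall>\<^sub>F t in F. g t \<in> S" "x \<in> S"
  shows "((\<lambda>t. f t (g t)) \<longlongrightarrow> l x) F"
proof (rule tendstoI)
  fix e :: real assume "0 < e"
  have "((\<lambda>t. l (g t)) \<longlongrightarrow> l x) F"
    by (rule continuous_on_tendsto_compose[OF l g(1,3,2)])
  then have "\<forall>\<^sub>F t in F. dist (l (g t)) (l x) < e / 2"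
    using \<open>0 < e\<close> by (intro tendstoD) auto
  moreover have "\<forall>\<^sub>F t in F. \<forall>y\<in>S. dist (f t y) (l y) < e / 2"
    using \<open>0 < e\<close> by (intro uniform_limitD[OF lim]) auto
  ultimately show "\<forall>\<^sub>F t in F. dist (f t (g t)) (l x) < e"
    using g(2) by eventually_elim (auto intro: dist_triangle_half_r dist_triangle_half_l simp: dist_commute)
qed

lemma welding_dist_quotient_le:
  assumes weld: "welding q L (A * t)" and t: "0 < t"
    and Q: "Q \<in> disc_algebra" "Im (Q 0) = 0" "M-lipschitz_on (cball 0 1) Q"
    and q_near: "\<And>w. cmod w = 1 \<Longrightarrow> dist (q w / of_real t) (Q w) \<le> e - 14 * M * A * t"
    and z: "z \<in> cball 0 1"
  shows "dist (L z / of_real t) (Q z) \<le> 2 * e + sqrt (2 * pi * e * (4 * A + M))"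
proof -
  interpret welding q L "A * t" by (rule weld)
  have factor: "2 * (t * e) + t * x = (2 * e + x) * t" for x
    by (simp add: algebra_simps)
  have "cmod (q w - of_real t * Q w) \<le> t * e - 14 * t * M * (A * t)" if "cmod w = 1" for w
  proof -
    have "cmod (q w - of_real t * Q w) \<le> (e - 14 * M * A * t) * t"
      using q_near[OF that] unfolding dist_divide_of_real[OF t] pos_divide_le_eq[OF t] .
    then show ?thesis by (simp add: algebra_simps)
  qed
  from norm_L_diff_le[OF Q _ this z]
  have "cmod (L z - of_real t * Q z) \<le> 2 * (t * e) + sqrt (2 * pi * (t * e) * (4 * (A * t) + t * M))"
    using t by simp
  also have "2 * pi * (t * e) * (4 * (A * t) + t * M) = t\<^sup>2 * (2 * pi * e * (4 * A + M))"
    by (simp add: power2_eq_square algebra_simps)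
  also have "sqrt \<dots> = t * sqrt (2 * pi * e * (4 * A + M))"
    unfolding real_sqrt_mult using t by simp
  finally show ?thesis
    unfolding dist_divide_of_real[OF t] pos_divide_le_eq[OF t] factor .
qed

lemma welding_uniform_limit:
  fixes q L :: "real \<Rightarrow> complex \<Rightarrow> complex"
  assumes weld: "\<forall>\<^sub>F t in at_right 0. welding (q t) (L t) (A * t)"
    and Q: "Q \<in> disc_algebra" "Im (Q 0) = 0" "M-lipschitz_on (cball 0 1) Q"
    and lim: "uniform_limit (sphere 0 1) (\<lambda>t w. q t w / of_real t) Q (at_right 0)"
  shows "uniform_limit (cball 0 1) (\<lambda>t z. L t z / of_real t) Q (at_right 0)"
proof (rule uniform_limitI)
  fix \<eta> :: real assume "\<eta> > 0"
  have "((\<lambda>e. 2 * e + sqrt (2 * pi * e * (4 * A + M))) \<longlongrightarrow>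
      2 * 0 + sqrt (2 * pi * 0 * (4 * A + M))) (at_right 0)"
    by (intro tendsto_intros)
  then have "\<forall>\<^sub>F e in at_right 0. 2 * e + sqrt (2 * pi * e * (4 * A + M)) < \<eta>"
    using \<open>\<eta> > 0\<close> by (intro order_tendstoD(2)) auto
  then have "\<forall>\<^sub>F e in at_right 0. 0 < e \<and> 2 * e + sqrt (2 * pi * e * (4 * A + M)) < \<eta>"
    by (intro eventually_conj eventually_at_right_less)
  then obtain e where e: "e > 0" "2 * e + sqrt (2 * pi * e * (4 * A + M)) < \<eta>"
    using eventually_happens[of _ "at_right (0::real)"] by auto
  have small: "\<forall>\<^sub>F t in at_right 0. 14 * M * A * t < e / 2"
    using e(1) by (intro eventually_at_right_0_mult_less) simp
  have near: "\<forall>\<^sub>F t in at_right 0. \<forall>w\<in>sphere 0 1. dist (q t w / of_real t) (Q w) < e / 2"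
    by (rule uniform_limitD[OF lim]) (use e(1) in simp)
  show "\<forall>\<^sub>F t in at_right 0. \<forall>z\<in>cball 0 1. dist (L t z / of_real t) (Q z) < \<eta>"
    using weld small near eventually_at_right_less[of 0]
  proof eventually_elim
    case (elim t)
    have "dist (q t w / of_real t) (Q w) \<le> e - 14 * M * A * t" if "cmod w = 1" for w
    proof -
      have "dist (q t w / of_real t) (Q w) < e / 2" using elim(3) that by simp
      with elim(2) show ?thesis by linarith
    qed
    from welding_dist_quotient_le[OF elim(1,4) Q this] show ?case
      using e(2) le_less_trans by blast
  qed
qed

section \<open>The exterior conformal map\<close>

lemma frontier_image_subset_image_frontier:
  fixes f :: "complex \<Rightarrow> complex"
  assumes "bounded S" "open S" "continuous_on (closure S) f" "f holomorphic_on S" "inj_on f S"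
  shows "frontier (f ` S) \<subseteq> f ` frontier S"
proof -
  have open_image: "open (f ` S)"
    by (rule open_mapping_thm3[OF assms(4,2,5)])
  have "closed (f ` closure S)"
    using assms(1,3) by (intro compact_imp_closed compact_continuous_image) (auto simp: compact_closure)
  then have "closure (f ` S) \<subseteq> f ` closure S"
    by (intro closure_minimal image_mono closure_subset)
  then have "frontier (f ` S) \<subseteq> f ` closure S - f ` S"
    using open_image by (auto simp: frontier_def interior_open)
  also have "\<dots> \<subseteq> f ` frontier S"
    using assms(2) by (auto simp: frontier_def interior_open)
  finally show ?thesis .
qed

lemma boundary_image_notin_image:
  fixes f :: "'a::t2_space \<Rightarrow> 'b::topological_space"
  assumes f: "continuous_on (closure U) f" and g: "continuous_on (f ` U) g" "\<And>x. x \<in> U \<Longrightarrow> g (f x) = x"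
    and z: "z \<in> closure U" "z \<notin> U"
  shows "f z \<notin> f ` U"
proof
  assume "f z \<in> f ` U"
  then obtain y where y: "y \<in> U" "f z = f y" by blast
  have nontrivial: "at z within U \<noteq> bot"
    using z by (simp add: closure_def trivial_limit_within)
  have "(f \<longlongrightarrow> f z) (at z within U)"
    using f z(1) tendsto_within_subset[OF _ closure_subset] unfolding continuous_on_def by blast
  then have "((\<lambda>x. g (f x)) \<longlongrightarrow> g (f z)) (at z within U)"
    by (rule continuous_on_tendsto_compose[OF g(1) _ \<open>f z \<in> f ` U\<close>]) (auto simp: eventually_at_filter)
  then have "((\<lambda>x. g (f x)) \<longlongrightarrow> y) (at z within U)"
    by (simp add: y g(2))
  then have "((\<lambda>x. x) \<longlongrightarrow> y) (at z within U)"
    by (rule Lim_transform_eventually) (auto simp: g(2) eventually_at_filter)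
  moreover have "((\<lambda>x. x) \<longlongrightarrow> z) (at z within U)"
    by (rule tendsto_ident_at)
  ultimately have "y = z"
    using tendsto_unique[OF nontrivial] by blast
  with y(1) z(2) show False by simp
qed

text \<open>The limit encodes the expansion \<open>F(z) = c z + b\<^sub>0 + b\<^sub>1/z + \<dots>\<close> at infinity, with \<open>c = e\<^bsup>-\<tau>\<^esup> > 0\<close>.\<close>
definition exterior_conformal_map :: "(complex \<Rightarrow> complex) \<Rightarrow> complex set \<Rightarrow> bool" where
  "exterior_conformal_map F \<Gamma> \<longleftrightarrow> F holomorphic_on {z. 1 < norm z} \<and> inj_on F {z. 1 < norm z} \<and>
     F ` {z. 1 < norm z} = outside \<Gamma> \<and> (\<exists>c>0. ((\<lambda>z. F z / z) \<longlongrightarrow> of_real c) at_infinity) \<and>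
     continuous_on {z. 1 \<le> norm z} F"

lemma closure_exterior_disc: "closure {z::complex. 1 < norm z} = {z. 1 \<le> norm z}"
proof -
  have "closure {z::complex. 1 < norm z} = closure (- cball 0 1)"
    by (rule arg_cong[where f = closure]) auto
  also have "\<dots> = {z. 1 \<le> norm z}"
    by (auto simp: closure_complement)
  finally show ?thesis .
qed

lemma exterior_conformal_map_boundary:
  assumes F: "exterior_conformal_map F \<Gamma>" and "closed \<Gamma>" "cmod z = 1"
  shows "F z \<in> \<Gamma>"
proof -
  let ?U = "{z::complex. 1 < norm z}"
  have cont: "continuous_on (closure ?U) F" and image: "F ` ?U = outside \<Gamma>"
    using F by (simp_all add: exterior_conformal_map_def closure_exterior_disc)
  have "open ?U" by (intro open_Collect_less continuous_intros)
  then obtain g where g: "g holomorphic_on F ` ?U" "\<And>z. z \<in> ?U \<Longrightarrow> g (F z) = z"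
    using holomorphic_has_inverse[of F ?U] F unfolding exterior_conformal_map_def by metis
  have "F z \<notin> outside \<Gamma>"
    unfolding image[symmetric]
    by (rule boundary_image_notin_image[OF cont holomorphic_on_imp_continuous_on[OF g(1)] g(2)])
       (use assms(3) in \<open>auto simp: closure_exterior_disc\<close>)
  moreover have "F z \<in> closure (outside \<Gamma>)"
    using image_closure_subset[OF cont closed_closure, of "outside \<Gamma>"] image closure_subset[of "outside \<Gamma>"]
      assms(3) by (auto simp: closure_exterior_disc)
  ultimately show ?thesis
    using closure_outside_subset[OF assms(2)] by blast
qed

lemma exterior_conformal_map_nonzero:
  assumes F: "exterior_conformal_map F (frontier \<Omega>)" and \<Omega>: "open \<Omega>" "bounded \<Omega>" "0 \<in> \<Omega>" and z: "1 \<le> cmod z"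
  shows "F z \<noteq> 0"
proof -
  have "0 \<notin> frontier \<Omega>" "0 \<notin> outside (frontier \<Omega>)"
    using \<Omega> outside_frontier_misses_closure[of \<Omega>] closure_subset[of \<Omega>]
    by (auto simp: frontier_def interior_open)
  moreover have "F z \<in> frontier \<Omega> \<union> outside (frontier \<Omega>)"
  proof (cases "cmod z = 1")
    case True
    then show ?thesis using exterior_conformal_map_boundary[OF F] by simp
  next
    case False
    then show ?thesis using F z unfolding exterior_conformal_map_def by auto
  qed
  ultimately show ?thesis by auto
qed

lemma holomorphic_on_if_exp_holomorphic_on:
  assumes "open S" "continuous_on S h" "(\<lambda>z. exp (h z)) holomorphic_on S"
  shows "h holomorphic_on S"
  unfolding holomorphic_on_open[OF assms(1)]
proof (intro ballI allI)
  fix x assume x: "x \<in> S"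
  define g where "g z = exp (h z)" for z
  have "(h \<longlongrightarrow> h x) (at x)"
    using assms(1,2) x by (simp add: continuous_on_eq_continuous_at isCont_def)
  then have "\<forall>\<^sub>F z in nhds x. dist (h z) (h x) < pi"
    by (simp add: tendstoD eventually_nhds_conv_at)
  then have near: "\<forall>\<^sub>F z in nhds x. h z = h x + Ln (g z / g x)"
  proof eventually_elim
    case (elim z)
    then have "\<bar>Im (h z - h x)\<bar> < pi"
      using abs_Im_le_cmod[of "h z - h x"] by (simp add: dist_norm)
    then have "Ln (exp (h z - h x)) = h z - h x"
      by (intro Ln_exp) auto
    then show ?case by (simp add: g_def exp_diff)
  qed
  have "(g has_field_derivative deriv g x) (at x)" "g x \<noteq> 0"
    using holomorphic_derivI[OF assms(3,1) x] by (simp_all add: g_def[abs_def])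
  then have "((\<lambda>z. h x + Ln (g z / g x)) has_field_derivative deriv g x / g x) (at x)"
    by (auto intro!: derivative_eq_intros)
  then show "\<exists>f'. (h has_field_derivative f') (at x)"
    unfolding DERIV_cong_ev[OF refl near refl, symmetric] by blast
qed

lemma disc_algebra_logarithm:
  assumes "g \<in> disc_algebra" "\<And>z. z \<in> cball 0 1 \<Longrightarrow> g z \<noteq> 0"
  obtains h where "h \<in> disc_algebra" "\<And>z. z \<in> cball 0 1 \<Longrightarrow> g z = exp (h z)"
proof -
  obtain h where h: "continuous_on (cball 0 1) h" "\<And>z. z \<in> cball 0 1 \<Longrightarrow> g z = exp (h z)"
    using continuous_logarithm_on_cball[OF disc_algebra_continuous_on[OF assms(1)] assms(2)] by blast
  have "(\<lambda>z. exp (h z)) holomorphic_on ball 0 1"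
    by (rule holomorphic_transform[OF disc_algebra_holomorphic_on[OF assms(1)]]) (simp add: h(2))
  then have "h holomorphic_on ball 0 1"
    by (rule holomorphic_on_if_exp_holomorphic_on[OF open_ball continuous_on_subset[OF h(1) ball_subset_cball]])
  from that[OF disc_algebraI[OF h(1) this] h(2)] show ?thesis .
qed

lemma exterior_reflection_in_disc_algebra:
  assumes hol: "F holomorphic_on {z. 1 < norm z}" and cont: "continuous_on {z. 1 \<le> norm z} F"
    and lim: "((\<lambda>z. F z / z) \<longlongrightarrow> c) at_infinity"
  shows "(\<lambda>z. if z = 0 then cnj c else z * cnj (F (cnj (1 / z)))) \<in> disc_algebra" (is "?g \<in> _")
proof -
  define G where "G z = z * cnj (F (cnj (1 / z)))" for z
  have "(cnj \<circ> F \<circ> cnj) holomorphic_on {z. 1 < norm z}"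
  proof (rule holomorphic_on_compose_cnj_cnj)
    have "cnj ` {z. 1 < norm z} \<subseteq> {z. 1 < norm z}" by auto
    then show "F holomorphic_on cnj ` {z. 1 < norm z}" by (rule holomorphic_on_subset[OF hol])
    show "open {z::complex. 1 < norm z}" by (intro open_Collect_less continuous_intros)
  qed
  then have "(\<lambda>z. z * (cnj \<circ> F \<circ> cnj) (1 / z)) holomorphic_on ball 0 1 - {0}"
    by (intro holomorphic_intros holomorphic_on_compose_gen[where g = "cnj \<circ> F \<circ> cnj" and f = "\<lambda>z. 1 / z",
          unfolded o_def[of _ "\<lambda>z. 1 / z"]])
       (auto simp: norm_divide)
  then have holG: "G holomorphic_on ball 0 1 - {0}"
    by (simp add: G_def[abs_def] o_def)
  have "filterlim (\<lambda>z::complex. inverse z) at_infinity (at 0)"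
    by (rule filterlim_inverse_at_infinity)
  then have "filterlim (\<lambda>z. cnj (1 / z)) at_infinity (at 0)"
    by (simp add: filterlim_at_infinity[OF order.refl] inverse_eq_divide norm_divide)
  from filterlim_compose[OF lim this]
  have "((\<lambda>z. cnj (F (cnj (1 / z)) / cnj (1 / z))) \<longlongrightarrow> cnj c) (at 0)"
    by (rule tendsto_cnj)
  then have "(G \<longlongrightarrow> cnj c) (at 0)"
    by (simp add: G_def[abs_def] divide_simps mult.commute cong: if_cong)
  from removable_singularity[OF holG open_ball this] have hol_g: "?g holomorphic_on ball 0 1"
    unfolding G_def .
  have "continuous_on (cball 0 1 - {0}) G"
    unfolding G_def
    by (intro continuous_intros continuous_on_compose2[OF cont]) (auto simp: norm_divide)
  then have "continuous_on (cball 0 1 - {0}) ?g"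
    by (rule continuous_on_eq) (auto simp: G_def)
  then have "continuous_on (cball 0 1) ?g"
    by (rule continuous_on_cball_if_punctured[OF zero_less_one _ holomorphic_on_imp_continuous_on[OF hol_g]])
  with hol_g show ?thesis by (rule disc_algebraI[rotated])
qed

lemma exterior_conformal_map_logarithm:
  assumes F: "exterior_conformal_map F \<Gamma>" and nonzero: "\<And>z. 1 \<le> norm z \<Longrightarrow> F z \<noteq> 0"
  obtains L where "L \<in> disc_algebra" "Im (L 0) = 0" "\<And>z. cmod z = 1 \<Longrightarrow> F z = z * exp (cnj (L z))"
proof -
  obtain c where c: "c > 0" "((\<lambda>z. F z / z) \<longlongrightarrow> of_real c) at_infinity"
    using F unfolding exterior_conformal_map_def by blast
  define g where "g z = (if z = 0 then of_real c else z * cnj (F (cnj (1 / z))))" for z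
  have "g \<in> disc_algebra"
    using exterior_reflection_in_disc_algebra[OF _ _ c(2), unfolded complex_cnj_complex_of_real] F
    unfolding exterior_conformal_map_def g_def[abs_def] by blast
  moreover have "g z \<noteq> 0" if "z \<in> cball 0 1" for z
    using that nonzero[of "cnj (1 / z)"] c(1) by (auto simp: g_def norm_divide)
  ultimately obtain h where h: "h \<in> disc_algebra" "\<And>z. z \<in> cball 0 1 \<Longrightarrow> g z = exp (h z)"
    using disc_algebra_logarithm by blast
  have "exp (h 0) = of_real c"
    using h(2)[of 0] by (simp add: g_def)
  moreover from this have "exp (Re (h 0)) = c"
    using c(1) by (metis abs_of_pos norm_exp_eq_Re norm_of_real)
  ultimately have exp_Im: "exp (\<i> * of_real (Im (h 0))) = 1"
    using exp_eq_polar[of "h 0"] c(1) by (simp add: cis_conv_exp)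
  define L where "L z = h z - \<i> * of_real (Im (h 0))" for z
  show ?thesis
  proof
    show "L \<in> disc_algebra" unfolding L_def by (intro disc_algebra_intros h)
    show "Im (L 0) = 0" by (simp add: L_def)
    fix z :: complex assume z: "cmod z = 1"
    then have unit: "cnj z * z = 1" by (simp add: complex_norm_square[symmetric] mult.commute)
    then have "cnj (1 / z) = z" "z \<noteq> 0" by (auto simp: divide_eq_eq mult.commute)
    then have "z * cnj (F z) = g z" by (simp add: g_def)
    also have "\<dots> = exp (L z)" using h(2)[of z] z exp_Im by (simp add: L_def exp_diff)
    finally have "cnj z * F z = cnj (exp (L z))" by (metis complex_cnj_cnj complex_cnj_mult)
    then have "z * exp (cnj (L z)) = (cnj z * z) * F z" by (simp add: exp_cnj)
    then show "F z = z * exp (cnj (L z))" by (simp only: unit mult_1)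
  qed
qed

section \<open>A maximum principle for transport equations\<close>

lemma has_real_derivative_nonneg_if_max_right:
  fixes g :: "real \<Rightarrow> real"
  assumes "(g has_real_derivative d) (at b within {a..b})" "a < b" "\<And>s. s \<in> {a..b} \<Longrightarrow> g s \<le> g b"
  shows "0 \<le> d"
proof (rule tendsto_lowerbound)
  show "((\<lambda>s. (g s - g b) / (s - b)) \<longlongrightarrow> d) (at b within {a..b})"
    using assms(1) by (simp add: has_field_derivative_iff)
  show "\<forall>\<^sub>F s in at b within {a..b}. 0 \<le> (g s - g b) / (s - b)"
    unfolding eventually_at_filter
    by (intro always_eventually allI impI divide_nonpos_nonpos) (use assms(3) in auto)
qed (use assms(2) in \<open>simp add: at_within_Icc_at_left\<close>)

lemma has_real_derivative_nonpos_if_max_left: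
  fixes g :: "real \<Rightarrow> real"
  assumes "(g has_real_derivative d) (at a)" "\<forall>\<^sub>F s in at_right a. g s \<le> g a"
  shows "d \<le> 0"
proof (rule tendsto_upperbound)
  show "((\<lambda>s. (g s - g a) / (s - a)) \<longlongrightarrow> d) (at_right a)"
    using DERIV_subset[OF assms(1)] by (simp add: has_field_derivative_iff)
  show "\<forall>\<^sub>F s in at_right a. (g s - g a) / (s - a) \<le> 0"
    using assms(2) eventually_at_right_less[of a] by eventually_elim (simp add: divide_nonpos_pos)
qed simp

lemma has_real_derivative_norm:
  fixes g :: "real \<Rightarrow> 'a::real_inner"
  assumes "(g has_vector_derivative g') (at t within S)" "g t \<noteq> 0"
  shows "((\<lambda>s. norm (g s)) has_real_derivative sgn (g t) \<bullet> g') (at t within S)"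
  using has_derivative_compose[OF assms(1)[unfolded has_vector_derivative_def] has_derivative_norm[OF assms(2)]]
  by (simp add: has_field_derivative_def inner_commute mult_commute_abs)

text \<open>
  The hypothesis reads \<open>\<partial>\<Phi>/\<partial>t - h\<cdot>\<nabla>\<Phi> \<le> 0\<close> wherever \<open>\<Phi> > 0\<close>, for a direction \<open>h\<close> pointing into \<open>S\<close>. At a maximum
  over \<open>S\<close>, even one on the boundary, \<open>h\<cdot>\<nabla>\<Phi> \<le> 0\<close>, so no boundary values have to be prescribed.
\<close>
lemma transport_maximum_principle:
  fixes \<Phi> :: "real \<Rightarrow> 'a::real_normed_vector \<Rightarrow> real"
  assumes S: "compact S" and cont: "continuous_on ({0..b} \<times> S) (\<lambda>(t, x). \<Phi> t x)"
    and init: "\<And>x. x \<in> S \<Longrightarrow> \<Phi> 0 x \<le> 0"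
    and deriv: "\<And>t x. 0 < t \<Longrightarrow> t \<le> b \<Longrightarrow> x \<in> S \<Longrightarrow> 0 < \<Phi> t x \<Longrightarrow>
       \<exists>h d e. (\<forall>\<^sub>F s in at_right 0. x + s *\<^sub>R h \<in> S) \<and>
         ((\<lambda>t. \<Phi> t x) has_real_derivative d) (at t within {0..t}) \<and>
         ((\<lambda>s. \<Phi> t (x + s *\<^sub>R h)) has_real_derivative e) (at 0) \<and> d \<le> e"
    and x: "x \<in> S" and t: "t \<in> {0..b}"
  shows "\<Phi> t x \<le> 0"
proof (rule ccontr)
  assume "\<not> \<Phi> t x \<le> 0"
  then have pos: "0 < \<Phi> t x" by simp
  define \<epsilon> where "\<epsilon> = \<Phi> t x / (t + 1)"
  have "\<epsilon> > 0" using pos t by (simp add: \<epsilon>_def)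
  have "\<epsilon> * t < \<Phi> t x"
    using pos t by (simp add: \<epsilon>_def field_simps)
  define \<Psi> where "\<Psi> = (\<lambda>(s, y). \<Phi> s y - \<epsilon> * s)"
  have "continuous_on ({0..b} \<times> S) \<Psi>"
    using continuous_on_diff[OF cont, of "\<lambda>z. \<epsilon> * fst z"]
    by (simp add: \<Psi>_def case_prod_unfold continuous_intros)
  then have "\<exists>z\<in>{0..b} \<times> S. \<forall>y\<in>{0..b} \<times> S. \<Psi> y \<le> \<Psi> z"
    using x t by (intro continuous_attains_sup compact_Times S compact_Icc) auto
  then obtain s y where sy_mem: "s \<in> {0..b}" "y \<in> S"
    and max: "\<And>s' y'. s' \<in> {0..b} \<Longrightarrow> y' \<in> S \<Longrightarrow> \<Phi> s' y' - \<epsilon> * s' \<le> \<Phi> s y - \<epsilon> * s"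
    by (auto simp: \<Psi>_def)
  have "0 < \<Phi> s y - \<epsilon> * s"
    using max[OF t x] \<open>\<epsilon> * t < \<Phi> t x\<close> by linarith
  moreover from this have "s \<noteq> 0"
    using init[OF sy_mem(2)] by auto
  moreover have "0 \<le> \<epsilon> * s"
    using \<open>\<epsilon> > 0\<close> sy_mem(1) by simp
  ultimately have s: "0 < s" "s \<le> b" and \<Phi>_pos: "0 < \<Phi> s y"
    using sy_mem(1) by auto
  obtain h d e where stays: "\<forall>\<^sub>F r in at_right 0. y + r *\<^sub>R h \<in> S"
    and d: "((\<lambda>t. \<Phi> t y) has_real_derivative d) (at s within {0..s})"
    and e: "((\<lambda>r. \<Phi> s (y + r *\<^sub>R h)) has_real_derivative e) (at 0)" and "d \<le> e"
    using deriv[OF s sy_mem(2) \<Phi>_pos] by blast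
  have "e \<le> 0"
    by (rule has_real_derivative_nonpos_if_max_left[OF e])
       (use stays max[OF sy_mem(1)] in \<open>auto elim: eventually_mono\<close>)
  have "((\<lambda>t. \<Phi> t y - \<epsilon> * t) has_real_derivative d - \<epsilon>) (at s within {0..s})"
    by (auto intro!: derivative_eq_intros d)
  then have "0 \<le> d - \<epsilon>"
    by (rule has_real_derivative_nonneg_if_max_right) (use s sy_mem(2) in \<open>auto intro!: max\<close>)
  with \<open>e \<le> 0\<close> \<open>d \<le> e\<close> \<open>\<epsilon> > 0\<close> show False by simp
qed

section \<open>Lipschitz estimates for holomorphic functions\<close>

lemma continuous_on_Times_lipschitz:
  fixes f :: "'a::metric_space \<Rightarrow> 'b::metric_space \<Rightarrow> 'c::metric_space"
  assumes "\<And>t. t \<in> T \<Longrightarrow> K-lipschitz_on X (f t)" "\<And>x. x \<in> X \<Longrightarrow> continuous_on T (\<lambda>t. f t x)"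
  shows "continuous_on (T \<times> X) (\<lambda>(t, x). f t x)"
proof (rule continuous_on_TimesI)
  show "local_lipschitz T X f"
    by (rule local_lipschitzI) (use assms(1) lipschitz_on_subset in \<open>blast intro: zero_less_one\<close>)
qed (rule assms(2))

lemma lipschitz_on_if_norm_deriv_le:
  assumes "convex S" "open S" "g holomorphic_on S" "\<And>z. z \<in> S \<Longrightarrow> cmod (deriv g z) \<le> B" "0 \<le> B"
  shows "B-lipschitz_on S g"
proof (rule lipschitz_onI)
  show "dist (g x) (g y) \<le> B * dist x y" if "x \<in> S" "y \<in> S" for x y
    unfolding dist_norm
    by (rule field_differentiable_bound[of S g "deriv g"])
       (use assms that in \<open>auto intro: holomorphic_derivI\<close>)
qed (rule assms(5))

lemma norm_deriv_le_if_lipschitz_on: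
  fixes g :: "'a::real_normed_field \<Rightarrow> 'a"
  assumes g: "(g has_field_derivative g') (at z)" and "open S" "z \<in> S" and lip: "B-lipschitz_on S g"
  shows "norm g' \<le> B"
proof (rule tendsto_upperbound)
  show "((\<lambda>w. norm ((g w - g z) / (w - z))) \<longlongrightarrow> norm g') (at z)"
    using g by (intro tendsto_norm) (simp add: has_field_derivative_iff)
  show "\<forall>\<^sub>F w in at z. norm ((g w - g z) / (w - z)) \<le> B"
    using eventually_at_in_open[OF assms(2,3)]
    by (rule eventually_mono)
       (use lipschitz_on_normD[OF lip _ assms(3)] in \<open>simp add: norm_divide pos_divide_le_eq\<close>)
qed simp

lemma bounded_holomorphic_lipschitz_on_cball:
  assumes g: "g holomorphic_on ball 0 R" "\<And>z. z \<in> ball 0 R \<Longrightarrow> cmod (g z) \<le> B" and r: "0 \<le> r" "r < R"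
  shows "(2 * B / (R - r))-lipschitz_on (cball 0 r) g"
proof (rule lipschitz_onI)
  show "0 \<le> 2 * B / (R - r)"
    using order_trans[OF norm_ge_zero g(2)[of 0]] r by simp
  have deriv_le: "cmod (deriv g z) \<le> 2 * B / (R - r)" if z: "z \<in> cball 0 r" for z
  proof -
    have cball_subset: "cball z ((R - r) / 2) \<subseteq> ball 0 R"
    proof
      fix w assume "w \<in> cball z ((R - r) / 2)"
      then have "cmod (w - z) \<le> (R - r) / 2" by (simp add: dist_norm norm_minus_commute)
      then show "w \<in> ball 0 R" using norm_triangle_sub[of w z] z r by (simp add: field_simps)
    qed
    have "cmod ((deriv ^^ 1) g z) \<le> fact 1 * B / ((R - r) / 2) ^ 1"
    proof (rule Cauchy_inequality)
      show "g holomorphic_on ball z ((R - r) / 2)"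
        by (rule holomorphic_on_subset[OF g(1) subset_trans[OF ball_subset_cball cball_subset]])
      show "continuous_on (cball z ((R - r) / 2)) g"
        by (rule holomorphic_on_imp_continuous_on[OF holomorphic_on_subset[OF g(1) cball_subset]])
      show "cmod (g w) \<le> B" if "cmod (z - w) = (R - r) / 2" for w
        using subsetD[OF cball_subset, of w] that by (intro g(2)) (simp add: dist_norm)
    qed (use r in auto)
    then show ?thesis by (simp add: mult.commute)
  qed
  have "(g has_field_derivative deriv g z) (at z within cball 0 r)" if "z \<in> cball 0 r" for z
    using that r by (intro DERIV_subset[OF holomorphic_derivI[OF g(1)]]) auto
  then show "dist (g x) (g y) \<le> 2 * B / (R - r) * dist x y" if "x \<in> cball 0 r" "y \<in> cball 0 r" for x y
    unfolding dist_norm by (rule field_differentiable_bound[OF convex_cball]) (use deriv_le that in auto)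
qed

section \<open>Boundary logarithm of a map close to the identity\<close>

definition log_ratio :: "(complex \<Rightarrow> complex) \<Rightarrow> complex \<Rightarrow> complex" where
  "log_ratio g z = Ln (g z / z)"

lemma Ln_lipschitz_near_1: "2-lipschitz_on (cball 1 (1/2)) Ln"
proof (rule lipschitz_onI)
  have "(Ln has_field_derivative inverse z) (at z within cball 1 (1/2))" "cmod (inverse z) \<le> 2"
    if "z \<in> cball 1 (1/2)" for z
  proof -
    have z: "cmod (1 - z) \<le> 1/2" using that by (simp add: dist_norm)
    have "Re z \<ge> 1/2" using z abs_Re_le_cmod[of "1 - z"] by simp
    then show "(Ln has_field_derivative inverse z) (at z within cball 1 (1/2))"
      by (intro has_field_derivative_at_within[OF has_field_derivative_Ln]) (simp add: complex_nonpos_Reals_iff)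
    have "cmod z \<ge> 1/2" using z norm_triangle_ineq2[of 1 "1 - z"] by simp
    then show "cmod (inverse z) \<le> 2" using le_imp_inverse_le[of "1/2" "cmod z"] by (simp add: norm_inverse)
  qed
  then show "dist (Ln x) (Ln y) \<le> 2 * dist x y" if "x \<in> cball 1 (1/2)" "y \<in> cball 1 (1/2)" for x y
    unfolding dist_norm by (rule field_differentiable_bound[OF convex_cball]) (use that in auto)
qed simp

locale near_identity =
  fixes g :: "complex \<Rightarrow> complex" and b :: real
  assumes diff_lipschitz: "b-lipschitz_on (cball 0 1) (\<lambda>z. g z - z)" and g_0: "g 0 = 0" and b_le: "b \<le> 1/4"
begin

lemma ratio_eq: "cmod z = 1 \<Longrightarrow> g z / z = 1 + (g z - z) / z"
  by (cases "z = 0") (simp_all add: field_simps)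

lemma norm_diff_le: "cmod z = 1 \<Longrightarrow> cmod (g z - z) \<le> b"
  using lipschitz_on_normD[OF diff_lipschitz, of z 0] g_0 by simp

lemma norm_ratio_diff_le: "cmod z = 1 \<Longrightarrow> cmod ((g z - z) / z) \<le> b"
  using norm_diff_le by (simp add: norm_divide)

lemma ratio_mem_cball: "cmod z = 1 \<Longrightarrow> g z / z \<in> cball 1 (1/2)"
  using norm_ratio_diff_le[of z] b_le by (simp add: ratio_eq dist_norm del: dist_add_cancel)

lemma mult_exp_log_ratio:
  assumes "cmod z = 1"
  shows "z * exp (log_ratio g z) = g z"
proof -
  have "g z / z \<noteq> 0" using ratio_mem_cball[OF assms] by auto
  then show ?thesis by (auto simp: log_ratio_def)
qed

lemma norm_log_ratio_le:
  assumes "cmod z = 1"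
  shows "cmod (log_ratio g z) \<le> 2 * b"
proof -
  have "cmod (log_ratio g z) \<le> 2 * cmod ((g z - z) / z)"
    unfolding log_ratio_def ratio_eq[OF assms] using norm_ratio_diff_le[OF assms] b_le
    by (intro norm_Ln_le) simp
  then show ?thesis using norm_ratio_diff_le[OF assms] by simp
qed

lemma log_ratio_approx:
  assumes "cmod z = 1"
  shows "cmod (log_ratio g z - (g z - z) / z) \<le> 2 * b\<^sup>2"
proof -
  define x where "x = (g z - z) / z"
  have x: "cmod x \<le> b" using norm_ratio_diff_le[OF assms] by (simp add: x_def)
  have "cmod (log_ratio g z - x) \<le> (cmod x)\<^sup>2 / (1 - cmod x)"
    unfolding log_ratio_def ratio_eq[OF assms] x_def[symmetric] using x b_le by (intro Ln_approx_linear) simp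
  also have "\<dots> \<le> b\<^sup>2 / (1/2)" using x b_le by (intro frac_le power_mono) auto
  finally show ?thesis by (simp add: x_def)
qed

lemma ratio_lipschitz: "(2 * b)-lipschitz_on (sphere 0 1) (\<lambda>z. g z / z)"
proof (rule lipschitz_onI)
  show "0 \<le> 2 * b" using lipschitz_on_nonneg[OF diff_lipschitz] by simp
  fix z w :: complex assume "z \<in> sphere 0 1" "w \<in> sphere 0 1"
  then have z: "cmod z = 1" "z \<noteq> 0" and w: "cmod w = 1" "w \<noteq> 0" by auto
  have "g z / z - g w / w = ((g z - z) - (g w - w)) / z + (g w - w) / w * ((w - z) / z)"
    using z w by (simp add: field_simps)
  also have "cmod \<dots> \<le> cmod (((g z - z) - (g w - w)) / z) + cmod ((g w - w) / w * ((w - z) / z))"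
    by (rule norm_triangle_ineq)
  also have "\<dots> = cmod ((g z - z) - (g w - w)) + cmod (g w - w) * cmod (z - w)"
    using z w by (simp add: norm_mult norm_divide norm_minus_commute[of w z])
  also have "\<dots> \<le> b * cmod (z - w) + b * cmod (z - w)"
    using z w norm_diff_le[of w] by (intro add_mono mult_right_mono lipschitz_on_normD[OF diff_lipschitz]) auto
  finally show "dist (g z / z) (g w / w) \<le> 2 * b * dist z w"
    by (simp add: dist_norm)
qed

lemma log_ratio_lipschitz: "(4 * b)-lipschitz_on (sphere 0 1) (log_ratio g)"
proof -
  have "(2 * (2 * b))-lipschitz_on (sphere 0 1) (\<lambda>z. Ln (g z / z))"
    by (rule lipschitz_on_compose2[OF ratio_lipschitz lipschitz_on_subset[OF Ln_lipschitz_near_1]])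
       (use ratio_mem_cball in auto)
  then show ?thesis by (simp add: log_ratio_def[abs_def])
qed

lemma norm_log_ratio_quotient_le:
  assumes "0 < t" "cmod z = 1"
  shows "cmod (log_ratio g z / of_real t + c) \<le> cmod ((g z - z) / of_real t + z * c) + 2 * b\<^sup>2 / t"
proof -
  define r where "r = log_ratio g z - (g z - z) / z"
  have "z \<noteq> 0" using assms(2) by auto
  then have "log_ratio g z / of_real t + c = ((g z - z) / of_real t + z * c) / z + r / of_real t"
    using assms(1) by (simp add: r_def field_simps)
  moreover have "cmod (r / of_real t) \<le> 2 * b\<^sup>2 / t"
    using log_ratio_approx[OF assms(2)] assms(1) by (simp add: r_def norm_divide divide_right_mono)
  ultimately show ?thesis
    using norm_triangle_ineq[of "((g z - z) / of_real t + z * c) / z" "r / of_real t"] assms(2)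
    by (simp add: norm_divide)
qed

end

section \<open>The Loewner-Kufarev equation near \<open>t = 0\<close>\<close>

lemma inward_flow_stays_in_cball:
  fixes a P :: complex
  assumes "Re P > 0" "a \<in> cball 0 r"
  shows "\<forall>\<^sub>F s in at_right 0. a + s *\<^sub>R (- (a * P)) \<in> cball 0 r"
proof -
  have "P \<noteq> 0" using assms(1) by auto
  have "\<forall>\<^sub>F s in at_right 0. 0 < s \<and> s < 2 * Re P / (cmod P)\<^sup>2"
    using assms(1) \<open>P \<noteq> 0\<close> by (intro eventually_at_rightI[of 0 "2 * Re P / (cmod P)\<^sup>2"]) auto
  then show ?thesis
  proof eventually_elim
    case (elim s)
    have "(cmod (1 - of_real s * P))\<^sup>2 = 1 - s * (2 * Re P - s * (cmod P)\<^sup>2)"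
      unfolding cmod_power2 by (simp add: power2_eq_square algebra_simps)
    moreover have "s * (cmod P)\<^sup>2 \<le> 2 * Re P"
      using elim \<open>P \<noteq> 0\<close> by (simp add: pos_less_divide_eq)
    ultimately have "(cmod (1 - of_real s * P))\<^sup>2 \<le> 1\<^sup>2" using elim by simp
    then have "cmod (1 - of_real s * P) \<le> 1" by (rule power2_le_imp_le) simp
    then have "cmod a * cmod (1 - of_real s * P) \<le> cmod a"
      by (intro mult_left_le) auto
    moreover have "a + s *\<^sub>R (- (a * P)) = a * (1 - of_real s * P)"
      by (simp add: scaleR_conv_of_real algebra_simps)
    ultimately show ?case using assms(2) by (simp add: norm_mult)
  qed
qed

locale Loewner_Kufarev =
  fixes p f :: "complex \<Rightarrow> real \<Rightarrow> complex" and T M :: real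
  assumes T_pos: "0 < T"
    and p_disc_algebra: "t \<in> {0..<T} \<Longrightarrow> (\<lambda>z. p z t) \<in> disc_algebra"
    and p_0: "t \<in> {0..<T} \<Longrightarrow> p 0 t = 1"
    and Re_p_pos: "t \<in> {0..<T} \<Longrightarrow> z \<in> ball 0 1 \<Longrightarrow> 0 < Re (p z t)"
    and norm_p_le: "t \<in> {0..<T} \<Longrightarrow> z \<in> cball 0 1 \<Longrightarrow> cmod (p z t) \<le> M"
    and norm_deriv_p_le: "t \<in> {0..<T} \<Longrightarrow> z \<in> ball 0 1 \<Longrightarrow> cmod (deriv (\<lambda>w. p w t) z) \<le> M"
    and p_continuous: "z \<in> cball 0 1 \<Longrightarrow> continuous_on {0..<T} (p z)"
    and f_disc_algebra: "t \<in> {0..<T} \<Longrightarrow> (\<lambda>z. f z t) \<in> disc_algebra"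
    and f_inj: "t \<in> {0..<T} \<Longrightarrow> inj_on (\<lambda>z. f z t) (ball 0 1)"
    and f_ball: "t \<in> {0..<T} \<Longrightarrow> z \<in> ball 0 1 \<Longrightarrow> f z t \<in> ball 0 1"
    and f_0: "t \<in> {0..<T} \<Longrightarrow> f 0 t = 0"
    and f_init: "z \<in> ball 0 1 \<Longrightarrow> f z 0 = z"
    and Loewner_Kufarev_equation: "t \<in> {0..<T} \<Longrightarrow> z \<in> ball 0 1 \<Longrightarrow>
       (f z has_vector_derivative (- z * deriv (\<lambda>w. f w t) z * p z t)) (at t within {0..<T})"
begin

abbreviation \<Omega> :: "real \<Rightarrow> complex set" where
  "\<Omega> t \<equiv> (\<lambda>z. f z t) ` ball 0 1"

abbreviation boundary_log :: "real \<Rightarrow> complex \<Rightarrow> complex" where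
  "boundary_log t \<equiv> log_ratio (\<lambda>z. f z t)"

lemma M_nonneg: "0 \<le> M"
  using norm_p_le[of 0 0] T_pos order_trans[OF norm_ge_zero] by auto

lemma p_lipschitz:
  assumes "t \<in> {0..<T}"
  shows "M-lipschitz_on (cball 0 1) (\<lambda>z. p z t)"
proof -
  have "M-lipschitz_on (closure (ball 0 1)) (\<lambda>z. p z t)"
    using norm_deriv_p_le[OF assms] M_nonneg p_disc_algebra[OF assms]
    by (intro lipschitz_on_closure lipschitz_on_if_norm_deriv_le) (auto simp: disc_algebra_def)
  then show ?thesis by simp
qed

definition velocity :: "real \<Rightarrow> complex \<Rightarrow> complex" where
  "velocity t z = - (z * p z t)"

lemma velocity_lipschitz:
  assumes t: "t \<in> {0..<T}"
  shows "(2 * M)-lipschitz_on (cball 0 1) (velocity t)"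
proof (rule lipschitz_onI)
  fix a b :: complex assume ab: "a \<in> cball 0 1" "b \<in> cball 0 1"
  have "velocity t a - velocity t b = (b - a) * p a t + b * (p b t - p a t)"
    by (simp add: velocity_def algebra_simps)
  then have "cmod (velocity t a - velocity t b) \<le> cmod (b - a) * cmod (p a t) + cmod b * cmod (p b t - p a t)"
    by (metis norm_mult norm_triangle_ineq)
  also have "\<dots> \<le> cmod (b - a) * M + 1 * (M * cmod (b - a))"
    using ab norm_p_le[OF t ab(1)] lipschitz_on_normD[OF p_lipschitz[OF t]]
    by (intro add_mono mult_mono) auto
  finally show "dist (velocity t a) (velocity t b) \<le> 2 * M * dist a b"
    by (simp add: dist_norm norm_minus_commute[of b a])
qed (use M_nonneg in simp)

lemma velocity_stays_in_cball:
  assumes "t \<in> {0..<T}" "z \<in> ball 0 1" "z \<in> cball 0 r"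
  shows "\<forall>\<^sub>F s in at_right 0. z + s *\<^sub>R velocity t z \<in> cball 0 r"
  unfolding velocity_def by (rule inward_flow_stays_in_cball[OF Re_p_pos[OF assms(1,2)] assms(3)])

lemma f_has_time_derivative:
  assumes "0 < t" "t < T" "z \<in> ball 0 1"
  shows "(f z has_vector_derivative deriv (\<lambda>w. f w t) z * velocity t z) (at t)"
proof -
  have "at t within {0..<T} = at t"
    using assms by (intro at_within_interior) simp
  then show ?thesis
    using Loewner_Kufarev_equation[of t z] assms by (simp add: velocity_def mult_ac)
qed

lemma f_has_flow_derivative:
  assumes t: "t \<in> {0..<T}" and z: "z \<in> ball 0 1"
  shows "((\<lambda>s. f (z + s *\<^sub>R h) t) has_vector_derivative deriv (\<lambda>w. f w t) z * h) (at 0)"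
proof -
  have "((\<lambda>w. f w t) has_field_derivative deriv (\<lambda>w. f w t) z) (at (z + 0 *\<^sub>R h))"
    using z disc_algebra_holomorphic_on[OF f_disc_algebra[OF t]] by (simp add: holomorphic_derivI)
  moreover have "((\<lambda>s. z + s *\<^sub>R h) has_vector_derivative h) (at 0)"
    by (auto intro!: derivative_eq_intros)
  ultimately have "((\<lambda>w. f w t) \<circ> (\<lambda>s. z + s *\<^sub>R h) has_vector_derivative h * deriv (\<lambda>w. f w t) z) (at 0)"
    by (intro field_vector_diff_chain_at)
  then show ?thesis by (simp add: o_def mult.commute)
qed

lemma f_continuous_in_time: "z \<in> ball 0 1 \<Longrightarrow> continuous_on {0..<T} (f z)"
  by (rule continuous_on_vector_derivative[OF Loewner_Kufarev_equation])

lemma f_continuous_on_Times: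
  assumes "0 \<le> r" "r < 1"
  shows "continuous_on ({0..<T} \<times> cball 0 r) (\<lambda>(t, z). f z t)"
proof (rule continuous_on_Times_lipschitz)
  show "(2 * 1 / (1 - r))-lipschitz_on (cball 0 r) (\<lambda>z. f z t)" if "t \<in> {0..<T}" for t
    using f_ball[OF that] disc_algebra_holomorphic_on[OF f_disc_algebra[OF that]] assms
    by (intro bounded_holomorphic_lipschitz_on_cball) (auto intro: less_imp_le)
  show "continuous_on {0..<T} (\<lambda>t. f z t)" if "z \<in> cball 0 r" for z
    using f_continuous_in_time that assms by auto
qed

definition displacement_diff :: "real \<Rightarrow> complex \<times> complex \<Rightarrow> complex" where
  "displacement_diff t = (\<lambda>(a, b). (f a t - a) - (f b t - b))"

text \<open>
  \<open>\<partial>/\<partial>t - velocity\<cdot>\<nabla>\<close> maps \<open>displacement_diff t (a, b)\<close> to \<open>H = velocity t a - velocity t b\<close> and \<open>a - b\<close> to \<open>-H\<close>.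
  As \<open>|H| \<le> 2M|a - b|\<close>, it is nonpositive on \<open>Lipschitz_defect\<close>: \<open>m(t) = exp (2Mt) - 1\<close> solves \<open>m' = 2M(1 + m)\<close>.
\<close>
definition Lipschitz_defect :: "real \<Rightarrow> complex \<times> complex \<Rightarrow> real" where
  "Lipschitz_defect t x = cmod (displacement_diff t x) - (exp (2 * M * t) - 1) * cmod (fst x - snd x)"

lemma displacement_diff_derivatives:
  assumes t: "0 < t" "t < T" and ab: "a \<in> ball 0 1" "b \<in> ball 0 1"
  obtains V where
    "((\<lambda>t. displacement_diff t (a, b)) has_vector_derivative V) (at t)"
    "((\<lambda>s. displacement_diff t ((a, b) + s *\<^sub>R (velocity t a, velocity t b))) has_vector_derivative
       V - (velocity t a - velocity t b)) (at 0)"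
proof
  define V where "V z = deriv (\<lambda>w. f w t) z * velocity t z" for z
  show "((\<lambda>t. displacement_diff t (a, b)) has_vector_derivative V a - V b) (at t)"
    unfolding displacement_diff_def V_def
    by (auto intro!: derivative_eq_intros f_has_time_derivative t ab)
  have "((\<lambda>s. (f (a + s *\<^sub>R velocity t a) t - (a + s *\<^sub>R velocity t a)) -
      (f (b + s *\<^sub>R velocity t b) t - (b + s *\<^sub>R velocity t b))) has_vector_derivative
      (V a - velocity t a) - (V b - velocity t b)) (at 0)"
    unfolding V_def using t ab
    by (intro has_vector_derivative_diff f_has_flow_derivative) (auto intro!: derivative_eq_intros)
  then show "((\<lambda>s. displacement_diff t ((a, b) + s *\<^sub>R (velocity t a, velocity t b))) has_vector_derivative
       V a - V b - (velocity t a - velocity t b)) (at 0)"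
    by (simp add: displacement_diff_def algebra_simps)
qed

lemma Lipschitz_defect_derivatives:
  fixes a b :: complex and t :: real
  defines "D \<equiv> displacement_diff t (a, b)" and "H \<equiv> velocity t a - velocity t b"
  assumes t: "0 < t" "t < T" and ab: "a \<in> ball 0 1" "b \<in> ball 0 1" "a \<noteq> b" and "D \<noteq> 0"
  obtains V where
    "((\<lambda>t. Lipschitz_defect t (a, b)) has_real_derivative
       sgn D \<bullet> V - 2 * M * exp (2 * M * t) * cmod (a - b)) (at t)"
    "((\<lambda>s. Lipschitz_defect t ((a, b) + s *\<^sub>R (velocity t a, velocity t b))) has_real_derivative
       sgn D \<bullet> (V - H) - (exp (2 * M * t) - 1) * (sgn (a - b) \<bullet> H)) (at 0)"
proof -
  let ?h = "(velocity t a, velocity t b)"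
  obtain V where V: "((\<lambda>t. displacement_diff t (a, b)) has_vector_derivative V) (at t)"
    "((\<lambda>s. displacement_diff t ((a, b) + s *\<^sub>R ?h)) has_vector_derivative V - H) (at 0)"
    using displacement_diff_derivatives[OF t ab(1,2)] unfolding H_def by blast
  have "((\<lambda>t. cmod (displacement_diff t (a, b))) has_real_derivative sgn D \<bullet> V) (at t)"
    using has_real_derivative_norm[OF V(1)] \<open>D \<noteq> 0\<close> by (simp add: D_def)
  then have time: "((\<lambda>t. Lipschitz_defect t (a, b)) has_real_derivative
      sgn D \<bullet> V - 2 * M * exp (2 * M * t) * cmod (a - b)) (at t)"
    unfolding Lipschitz_defect_def by (auto intro!: derivative_eq_intros)
  have "((\<lambda>s. cmod (displacement_diff t ((a, b) + s *\<^sub>R ?h))) has_real_derivative sgn D \<bullet> (V - H)) (at 0)"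
    using has_real_derivative_norm[OF V(2)] \<open>D \<noteq> 0\<close> by (simp add: D_def)
  moreover have "((\<lambda>s. (a - b) + s *\<^sub>R H) has_vector_derivative H) (at 0)"
    by (auto intro!: derivative_eq_intros)
  from has_real_derivative_norm[OF this]
  have "((\<lambda>s. cmod ((a - b) + s *\<^sub>R H)) has_real_derivative sgn (a - b) \<bullet> H) (at 0)"
    using ab(3) by simp
  moreover have "Lipschitz_defect t ((a, b) + s *\<^sub>R ?h) =
      cmod (displacement_diff t ((a, b) + s *\<^sub>R ?h)) - (exp (2 * M * t) - 1) * cmod ((a - b) + s *\<^sub>R H)" for s
    by (simp add: Lipschitz_defect_def H_def algebra_simps)
  ultimately have "((\<lambda>s. Lipschitz_defect t ((a, b) + s *\<^sub>R ?h)) has_real_derivative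
      sgn D \<bullet> (V - H) - (exp (2 * M * t) - 1) * (sgn (a - b) \<bullet> H)) (at 0)"
    by (simp only: DERIV_diff DERIV_cmult)
  from that[OF time this] show ?thesis .
qed

lemma Lipschitz_defect_decreasing:
  assumes t: "0 < t" "t < T" and ab: "a \<in> ball 0 1" "b \<in> ball 0 1" and pos: "0 < Lipschitz_defect t (a, b)"
  obtains d e where "((\<lambda>t. Lipschitz_defect t (a, b)) has_real_derivative d) (at t)"
    "((\<lambda>s. Lipschitz_defect t ((a, b) + s *\<^sub>R (velocity t a, velocity t b))) has_real_derivative e) (at 0)"
    "d \<le> e"
proof -
  define D where "D = displacement_diff t (a, b)"
  define m where "m = exp (2 * M * t) - 1"
  define H where "H = velocity t a - velocity t b"
  define A where "A = cmod (a - b)"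
  note defs = D_def m_def H_def A_def
  have "0 \<le> m" using M_nonneg t by (simp add: defs)
  then have "0 \<le> m * A" by (simp add: defs)
  then have "D \<noteq> 0"
    using pos by (auto simp: Lipschitz_defect_def defs)
  then have "a \<noteq> b"
    by (auto simp: defs displacement_diff_def)
  obtain V where
    V: "((\<lambda>t. Lipschitz_defect t (a, b)) has_real_derivative sgn D \<bullet> V - 2 * M * (1 + m) * A) (at t)"
    "((\<lambda>s. Lipschitz_defect t ((a, b) + s *\<^sub>R (velocity t a, velocity t b))) has_real_derivative
       sgn D \<bullet> (V - H) - m * (sgn (a - b) \<bullet> H)) (at 0)"
    using Lipschitz_defect_derivatives[OF t ab \<open>a \<noteq> b\<close>] \<open>D \<noteq> 0\<close> by (auto simp: defs)
  have "norm H \<le> 2 * M * A"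
    using lipschitz_on_normD[OF velocity_lipschitz, of t a b] t ab by (simp add: defs)
  then have "sgn D \<bullet> H \<le> 2 * M * A" "sgn (a - b) \<bullet> H \<le> 2 * M * A"
    using norm_cauchy_schwarz[of "sgn D" H] norm_cauchy_schwarz[of "sgn (a - b)" H] \<open>D \<noteq> 0\<close> \<open>a \<noteq> b\<close>
    by (simp_all add: norm_sgn)
  then have "sgn D \<bullet> H + m * (sgn (a - b) \<bullet> H) \<le> 2 * M * A + m * (2 * M * A)"
    using \<open>0 \<le> m\<close> by (intro add_mono mult_left_mono) auto
  then have "sgn D \<bullet> V - 2 * M * (1 + m) * A \<le> sgn D \<bullet> (V - H) - m * (sgn (a - b) \<bullet> H)"
    by (simp add: inner_diff_right algebra_simps)
  from that[OF V this] show ?thesis .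
qed

lemma Lipschitz_defect_nonpos:
  assumes t: "0 \<le> t" "t < T" and z: "z \<in> ball 0 1" "w \<in> ball 0 1"
  shows "Lipschitz_defect t (z, w) \<le> 0"
proof -
  define r where "r = max (cmod z) (cmod w)"
  have r: "0 \<le> r" "r < 1" using z by (auto simp: r_def le_max_iff_disj)
  define S where "S = cball (0::complex) r \<times> cball (0::complex) r"
  have S_ball: "S \<subseteq> ball 0 1 \<times> ball 0 1"
    using r by (auto simp: S_def)
  show ?thesis
  proof (rule transport_maximum_principle[where \<Phi> = Lipschitz_defect and S = S and b = t])
    show "compact S" unfolding S_def by (intro compact_Times compact_cball)
    have "continuous_on ({0..t} \<times> S) (\<lambda>y. f (fst (snd y)) (fst y))"
      "continuous_on ({0..t} \<times> S) (\<lambda>y. f (snd (snd y)) (fst y))"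
      using continuous_on_compose2[OF f_continuous_on_Times[OF r], of "{0..t} \<times> S" "\<lambda>y. (fst y, fst (snd y))"]
        continuous_on_compose2[OF f_continuous_on_Times[OF r], of "{0..t} \<times> S" "\<lambda>y. (fst y, snd (snd y))"] t
      by (force simp: S_def intro!: continuous_intros)+
    then show "continuous_on ({0..t} \<times> S) (\<lambda>(t, x). Lipschitz_defect t x)"
      unfolding Lipschitz_defect_def displacement_diff_def case_prod_unfold by (intro continuous_intros)
    show "Lipschitz_defect 0 x \<le> 0" if "x \<in> S" for x
      using that S_ball f_init by (auto simp: Lipschitz_defect_def displacement_diff_def)
    show "\<exists>h d e. (\<forall>\<^sub>F s in at_right 0. x + s *\<^sub>R h \<in> S) \<and>
         ((\<lambda>t. Lipschitz_defect t x) has_real_derivative d) (at u within {0..u}) \<and>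
         ((\<lambda>s. Lipschitz_defect u (x + s *\<^sub>R h)) has_real_derivative e) (at 0) \<and> d \<le> e"
      if u: "0 < u" "u \<le> t" and x: "x \<in> S" and pos: "0 < Lipschitz_defect u x" for u x
    proof -
      obtain a b where ab: "x = (a, b)" "a \<in> cball 0 r" "b \<in> cball 0 r" "a \<in> ball 0 1" "b \<in> ball 0 1"
        using x r by (cases x) (auto simp: S_def)
      have u_mem: "u \<in> {0..<T}" "u < T" using u t by auto
      have "\<forall>\<^sub>F s in at_right 0. x + s *\<^sub>R (velocity u a, velocity u b) \<in> S"
        using velocity_stays_in_cball[OF u_mem(1) ab(4,2)] velocity_stays_in_cball[OF u_mem(1) ab(5,3)]
        by eventually_elim (simp add: S_def ab(1))
      moreover obtain d e where "((\<lambda>t. Lipschitz_defect t x) has_real_derivative d) (at u)"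
        "((\<lambda>s. Lipschitz_defect u (x + s *\<^sub>R (velocity u a, velocity u b))) has_real_derivative e) (at 0)"
        "d \<le> e"
        using Lipschitz_defect_decreasing[OF u(1) u_mem(2) ab(4,5)] pos unfolding ab(1) by blast
      ultimately show ?thesis
        using DERIV_subset by blast
    qed
  qed (use t in \<open>auto simp: S_def r_def\<close>)
qed

lemma displacement_lipschitz:
  assumes t: "t \<in> {0..<T}" and small: "2 * M * t \<le> 1"
  shows "(4 * M * t)-lipschitz_on (cball 0 1) (\<lambda>z. f z t - z)"
proof -
  have "(exp (2 * M * t) - 1)-lipschitz_on (ball 0 1) (\<lambda>z. f z t - z)"
  proof (rule lipschitz_onI)
    show "dist (f z t - z) (f w t - w) \<le> (exp (2 * M * t) - 1) * dist z w"
      if "z \<in> ball 0 1" "w \<in> ball 0 1" for z w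
      using Lipschitz_defect_nonpos[of t z w] t that
      by (simp add: Lipschitz_defect_def displacement_diff_def dist_norm)
    show "0 \<le> exp (2 * M * t) - 1"
      using M_nonneg t by simp
  qed
  moreover have "exp (2 * M * t) - 1 \<le> 4 * M * t"
  proof -
    have "(2 * M * t)\<^sup>2 \<le> 2 * M * t"
      unfolding power2_eq_square using M_nonneg t small by (intro mult_left_le) auto
    then show ?thesis
      using exp_bound[of "2 * M * t"] M_nonneg t small by simp
  qed
  ultimately have "(4 * M * t)-lipschitz_on (ball 0 1) (\<lambda>z. f z t - z)"
    by (rule lipschitz_on_mono[OF _ subset_refl])
  then have "(4 * M * t)-lipschitz_on (closure (ball 0 1)) (\<lambda>z. f z t - z)"
    using disc_algebra_continuous_on[OF f_disc_algebra[OF t]]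
    by (intro lipschitz_on_closure continuous_intros) auto
  then show ?thesis by simp
qed

lemma norm_displacement_first_order_le:
  assumes t: "0 < t" "t < T" "2 * M * t \<le> 1" and z: "z \<in> ball 0 1"
    and near: "\<And>s. 0 < s \<Longrightarrow> s < t \<Longrightarrow> cmod (p z s - p z 0) \<le> e"
  shows "cmod (f z t - z + of_real t * (z * p z 0)) \<le> t * (e + 4 * M\<^sup>2 * t)"
proof -
  define g where "g s = f z s - z + s *\<^sub>R (z * p z 0)" for s
  define g' where "g' s = deriv (\<lambda>w. f w s) z * velocity s z + z * p z 0" for s
  have norm_g': "norm (g' s) \<le> e + 4 * M\<^sup>2 * t" if s: "0 < s" "s < t" for s
  proof -
    have s_mem: "s \<in> {0..<T}" and M_s_le: "M * s \<le> M * t"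
      using s t M_nonneg by (auto intro: mult_left_mono)
    have lip: "(4 * M * s)-lipschitz_on (ball 0 1) (\<lambda>w. f w s - w)"
      by (rule lipschitz_on_subset[OF displacement_lipschitz[OF s_mem]]) (use M_s_le t in auto)
    have "((\<lambda>w. f w s - w) has_field_derivative deriv (\<lambda>w. f w s) z - 1) (at z)"
      using disc_algebra_holomorphic_on[OF f_disc_algebra[OF s_mem]]
      by (intro derivative_intros holomorphic_derivI[OF _ _ z]) auto
    then have "cmod (deriv (\<lambda>w. f w s) z - 1) \<le> 4 * M * t"
      using norm_deriv_le_if_lipschitz_on[OF _ open_ball z lip] M_s_le by fastforce
    then have "cmod (deriv (\<lambda>w. f w s) z - 1) * cmod (p z s) \<le> (4 * M * t) * M"
      using norm_p_le[OF s_mem, of z] z M_nonneg t by (intro mult_mono) auto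
    then have "cmod ((p z 0 - p z s) - (deriv (\<lambda>w. f w s) z - 1) * p z s) \<le> e + 4 * M\<^sup>2 * t"
      using near[OF s] norm_triangle_ineq4[of "p z 0 - p z s" "(deriv (\<lambda>w. f w s) z - 1) * p z s"]
      by (simp add: norm_mult norm_minus_commute[of "p z 0"] power2_eq_square mult_ac)
    moreover have "g' s = z * ((p z 0 - p z s) - (deriv (\<lambda>w. f w s) z - 1) * p z s)"
      by (simp add: g'_def velocity_def algebra_simps)
    ultimately show ?thesis
      using z mult_left_le_one_le[of "cmod _" "cmod z"] by (fastforce simp: norm_mult intro: order_trans)
  qed
  have "norm (g t - g 0) \<le> (e + 4 * M\<^sup>2 * t) * t - (e + 4 * M\<^sup>2 * t) * 0"
  proof (rule differentiable_bound_general[OF t(1) _ _ _ _ norm_g'])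
    show "continuous_on {0..t} g"
      unfolding g_def using t
      by (intro continuous_intros continuous_on_subset[OF f_continuous_in_time[OF z]]) auto
    show "(g has_vector_derivative g' s) (at s)" if "0 < s" "s < t" for s
      unfolding g_def g'_def using that t by (auto intro!: derivative_eq_intros f_has_time_derivative z)
    show "((\<lambda>s. (e + 4 * M\<^sup>2 * t) * s) has_vector_derivative e + 4 * M\<^sup>2 * t) (at s)" for s
      by (auto intro!: derivative_eq_intros simp flip: has_real_derivative_iff_has_vector_derivative)
  qed (auto intro!: continuous_intros)
  then show ?thesis
    using f_init[OF z] by (simp add: g_def scaleR_conv_of_real mult.commute)
qed

lemma norm_displacement_first_order_le_cball:
  assumes t: "0 < t" "t < T" "2 * M * t \<le> 1" and z: "z \<in> cball 0 1"
    and near: "\<And>s w. 0 < s \<Longrightarrow> s < t \<Longrightarrow> w \<in> ball 0 1 \<Longrightarrow> cmod (p w s - p w 0) \<le> e"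
  shows "cmod (f z t - z + of_real t * (z * p z 0)) \<le> t * (e + 4 * M\<^sup>2 * t)"
proof (rule continuous_on_closure_norm_le[of "ball 0 1" "\<lambda>z. f z t - z + of_real t * (z * p z 0)"])
  have "(\<lambda>z. f z t - z + of_real t * (z * p z 0)) \<in> disc_algebra"
    using t by (intro disc_algebra_intros f_disc_algebra p_disc_algebra) auto
  then show "continuous_on (closure (ball 0 1)) (\<lambda>z. f z t - z + of_real t * (z * p z 0))"
    by (simp add: disc_algebra_continuous_on)
  show "\<forall>w\<in>ball 0 1. cmod (f w t - w + of_real t * (w * p w 0)) \<le> t * (e + 4 * M\<^sup>2 * t)"
    using norm_displacement_first_order_le[OF t _ near] by blast
qed (use z in simp)

lemma p_uniform_limit: "uniform_limit (cball 0 1) (\<lambda>t z. p z t) (\<lambda>z. p z 0) (at_right 0)"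
proof (rule uniform_limitI)
  fix e :: real assume "0 < e"
  have "continuous_on ({0..T/2} \<times> cball 0 1) (\<lambda>(t, z). p z t)"
    using T_pos p_lipschitz
    by (intro continuous_on_Times_lipschitz[where K = M] continuous_on_subset[OF p_continuous]) auto
  then have "uniformly_continuous_on ({0..T/2} \<times> cball 0 1) (\<lambda>(t, z). p z t)"
    by (intro compact_uniformly_continuous compact_Times) auto
  then obtain d where d: "d > 0"
    "\<And>x y. x \<in> {0..T/2} \<times> cball 0 1 \<Longrightarrow> y \<in> {0..T/2} \<times> cball 0 1 \<Longrightarrow> dist y x < d \<Longrightarrow>
      dist (case y of (t, z) \<Rightarrow> p z t) (case x of (t, z) \<Rightarrow> p z t) < e"
    unfolding uniformly_continuous_on_def using \<open>0 < e\<close> by metis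
  have "\<forall>\<^sub>F t in at_right 0. 0 < t \<and> t < min d (T/2)"
    using d(1) T_pos by (intro eventually_at_rightI[of 0 "min d (T/2)"]) auto
  then show "\<forall>\<^sub>F t in at_right 0. \<forall>z\<in>cball 0 1. dist (p z t) (p z 0) < e"
  proof eventually_elim
    case (elim t)
    show ?case
      using d(2)[of "(0, _)" "(t, _)"] elim by (auto simp: dist_Pair_Pair)
  qed
qed

lemma eventually_time_small:
  assumes "0 < c"
  shows "\<forall>\<^sub>F t in at_right 0. 0 < t \<and> t < T \<and> M * t < c"
proof -
  have "\<forall>\<^sub>F t in at_right 0. 0 < t \<and> t < T"
    using T_pos by (intro eventually_at_rightI[of 0 T]) auto
  then show ?thesis
    using eventually_at_right_0_mult_less[OF assms, of M] by eventually_elim simp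
qed

lemma displacement_uniform_limit:
  "uniform_limit (cball 0 1) (\<lambda>t z. (f z t - z) / of_real t) (\<lambda>z. - (z * p z 0)) (at_right 0)"
proof (rule uniform_limitI)
  fix \<eta> :: real assume "0 < \<eta>"
  then have "\<forall>\<^sub>F s in at_right 0. \<forall>z\<in>cball 0 1. dist (p z s) (p z 0) < \<eta> / 4"
    by (intro uniform_limitD[OF p_uniform_limit]) simp
  then obtain d where d: "0 < d" "\<And>s z. 0 < s \<Longrightarrow> s < d \<Longrightarrow> z \<in> cball 0 1 \<Longrightarrow> dist (p z s) (p z 0) < \<eta> / 4"
    unfolding eventually_at_right_field by blast
  have "\<forall>\<^sub>F t in at_right 0. 4 * M\<^sup>2 * t < \<eta> / 4"
    using \<open>0 < \<eta>\<close> by (intro eventually_at_right_0_mult_less) simp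
  moreover have "\<forall>\<^sub>F t in at_right 0. t < d"
    using d(1) by (intro eventually_at_rightI[of 0 d]) auto
  moreover have "\<forall>\<^sub>F t in at_right 0. 0 < t \<and> t < T \<and> M * t < 1/2"
    by (rule eventually_time_small) simp
  ultimately show "\<forall>\<^sub>F t in at_right 0. \<forall>z\<in>cball 0 1. dist ((f z t - z) / of_real t) (- (z * p z 0)) < \<eta>"
  proof eventually_elim
    case (elim t)
    have "dist ((f z t - z) / of_real t) (- (z * p z 0)) \<le> \<eta> / 4 + 4 * M\<^sup>2 * t" if "z \<in> cball 0 1" for z
    proof -
      have "cmod (f z t - z + of_real t * (z * p z 0)) \<le> t * (\<eta> / 4 + 4 * M\<^sup>2 * t)"
        using d(2) elim that
        by (intro norm_displacement_first_order_le_cball) (auto simp: dist_norm less_imp_le)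
      then show ?thesis
        using elim by (simp add: dist_divide_of_real pos_divide_le_eq mult.commute)
    qed
    then show ?case
      using elim(1) \<open>0 < \<eta>\<close> by fastforce
  qed
qed

lemma near_identity_f:
  assumes "0 < t" "t < T" "16 * M * t \<le> 1"
  shows "near_identity (\<lambda>z. f z t) (4 * M * t)"
proof
  show "(4 * M * t)-lipschitz_on (cball 0 1) (\<lambda>z. f z t - z)"
    using assms M_nonneg by (intro displacement_lipschitz) auto
qed (use assms f_0 in auto)

lemma boundary_log_uniform_limit:
  "uniform_limit (sphere 0 1) (\<lambda>t w. boundary_log t w / of_real t) (\<lambda>w. - p w 0) (at_right 0)"
proof -
  have "uniform_limit (sphere 0 1) (\<lambda>t w. boundary_log t w / of_real t + p w 0) (\<lambda>w. 0) (at_right 0)"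
  proof (rule uniform_limit_null_comparison)
    have "\<forall>\<^sub>F t in at_right 0. 0 < t \<and> t < T \<and> M * t < 1/16"
      by (rule eventually_time_small) simp
    then show "\<forall>\<^sub>F t in at_right 0. \<forall>w\<in>sphere 0 1. cmod (boundary_log t w / of_real t + p w 0) \<le>
        cmod ((f w t - w) / of_real t + w * p w 0) + 32 * M\<^sup>2 * t"
    proof eventually_elim
      case (elim t)
      then interpret near_identity "\<lambda>z. f z t" "4 * M * t"
        by (intro near_identity_f) auto
      have "2 * (4 * M * t)\<^sup>2 / t = 32 * M\<^sup>2 * t"
        using elim by (simp add: power2_eq_square)
      then show ?case
        using norm_log_ratio_quotient_le[of t _ "p _ 0"] elim by auto
    qed
    have "uniform_limit (sphere 0 1) (\<lambda>t w. (f w t - w) / of_real t + w * p w 0)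
        (\<lambda>w. - (w * p w 0) + w * p w 0) (at_right 0)"
      by (intro uniform_limit_add uniform_limit_const uniform_limit_on_subset[OF displacement_uniform_limit]) auto
    moreover have "((\<lambda>t. 32 * M\<^sup>2 * t) \<longlongrightarrow> 32 * M\<^sup>2 * 0) (at_right 0)"
      by (intro tendsto_intros)
    then have "uniform_limit (sphere 0 1) (\<lambda>t w. 32 * M\<^sup>2 * t) (\<lambda>w::complex. 0) (at_right 0)"
      by (simp add: uniform_limit_iff tendsto_iff eventually_mono)
    ultimately show "uniform_limit (sphere 0 1)
        (\<lambda>t w. cmod ((f w t - w) / of_real t + w * p w 0) + 32 * M\<^sup>2 * t) (\<lambda>w. 0) (at_right 0)"
      using uniform_limit_add[OF uniform_limit_norm] by fastforce
  qed
  from uniform_limit_add[OF this uniform_limit_const[where c = "\<lambda>w. - p w 0"]] show ?thesis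
    by simp
qed

lemma exterior_logarithm:
  assumes t: "t \<in> {0..<T}" and F: "exterior_conformal_map F (frontier (\<Omega> t))"
  obtains L where "L \<in> disc_algebra" "Im (L 0) = 0" "\<And>z. cmod z = 1 \<Longrightarrow> F z = z * exp (cnj (L z))"
proof (rule exterior_conformal_map_logarithm[OF F])
  have "open (\<Omega> t)"
    by (rule open_mapping_thm3[OF disc_algebra_holomorphic_on[OF f_disc_algebra[OF t]] open_ball f_inj[OF t]])
  moreover have "bounded (\<Omega> t)"
    using f_ball[OF t] by (intro bounded_subset[OF bounded_ball[of 0 1]]) auto
  moreover have "0 \<in> \<Omega> t"
    using f_0[OF t] by force
  ultimately show "F z \<noteq> 0" if "1 \<le> cmod z" for z
    using exterior_conformal_map_nonzero[OF F _ _ _ that] by blast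
qed (rule that)

lemma exterior_map_welded_point:
  assumes t: "t \<in> {0..<T}" and F: "exterior_conformal_map F (frontier (\<Omega> t))"
    and z: "cmod z = 1"
  obtains w where "cmod w = 1" "f w t = F z"
proof -
  have "F z \<in> frontier (\<Omega> t)"
    by (rule exterior_conformal_map_boundary[OF F frontier_closed z])
  also have "\<dots> \<subseteq> (\<lambda>z. f z t) ` frontier (ball 0 1)"
    using f_disc_algebra[OF t] f_inj[OF t]
    by (intro frontier_image_subset_image_frontier) (auto simp: disc_algebra_def)
  finally show ?thesis
    using that by auto
qed

lemma welding_boundary_log:
  assumes t: "0 < t" "t < T" "512 * M * t \<le> 1"
    and F: "exterior_conformal_map F (frontier (\<Omega> t))"
    and L: "L \<in> disc_algebra" "Im (L 0) = 0" "\<And>z. cmod z = 1 \<Longrightarrow> F z = z * exp (cnj (L z))"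
  shows "welding (boundary_log t) L (16 * M * t)"
proof -
  interpret near_identity "\<lambda>z. f z t" "4 * M * t"
    using t M_nonneg by (intro near_identity_f) auto
  show ?thesis
  proof
    show "(16 * M * t)-lipschitz_on (sphere 0 1) (boundary_log t)"
      using log_ratio_lipschitz by (simp add: mult.assoc)
    show "cmod (boundary_log t w) \<le> 16 * M * t" if "cmod w = 1" for w
      using norm_log_ratio_le[OF that] M_nonneg t by (simp add: order_trans)
    fix z :: complex assume z: "cmod z = 1"
    obtain w where "cmod w = 1" "f w t = F z"
      using exterior_map_welded_point[OF _ F z] t by auto
    then show "\<exists>w. cmod w = 1 \<and> w * exp (boundary_log t w) = z * exp (cnj (L z))"
      using mult_exp_log_ratio[of w] L(3)[OF z] by auto
  qed (use t L in auto)
qed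

lemma boundary_log_tendsto:
  assumes "(\<psi> \<longlongrightarrow> \<theta>) (at_right 0)"
  shows "((\<lambda>t. boundary_log t (cis (\<psi> t)) / of_real t) \<longlongrightarrow> - p (cis \<theta>) 0) (at_right 0)"
proof (rule uniform_limit_tendsto_compose[OF boundary_log_uniform_limit])
  have "continuous_on (cball 0 1) (\<lambda>z. p z 0)"
    using T_pos by (intro disc_algebra_continuous_on p_disc_algebra) simp
  then show "continuous_on (sphere 0 1) (\<lambda>w. - p w 0)"
    by (intro continuous_intros) (auto elim: continuous_on_subset)
  show "((\<lambda>t. cis (\<psi> t)) \<longlongrightarrow> cis \<theta>) (at_right 0)"
    by (intro tendsto_intros assms)
qed auto

lemma welded_angle_quotient:
  assumes t: "0 < t" "t < T" "16 * M * t \<le> 1" and weld: "welding (boundary_log t) L \<epsilon>"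
    and "f (cis \<psi>) t = cis \<theta> * exp (cnj (L (cis \<theta>)))" "\<bar>\<psi> - \<theta>\<bar> \<le> 1"
  shows "Im (cnj (L (cis \<theta>) / of_real t) - boundary_log t (cis \<psi>) / of_real t) = (\<psi> - \<theta>) / t"
proof -
  interpret near_identity "\<lambda>z. f z t" "4 * M * t"
    by (rule near_identity_f[OF t])
  have "cis \<psi> * exp (boundary_log t (cis \<psi>)) = cis \<theta> * exp (cnj (L (cis \<theta>)))"
    using mult_exp_log_ratio[of "cis \<psi>"] assms(5) by simp
  from welding.angle_diff_eq[OF weld this assms(6)] show ?thesis
    by (simp add: Im_divide_of_real diff_divide_distrib)
qed

theorem welding_first_order:
  fixes F :: "real \<Rightarrow> complex \<Rightarrow> complex" and \<psi> :: "real \<Rightarrow> real"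
  assumes F: "\<And>t. t \<in> {0..<T} \<Longrightarrow> exterior_conformal_map (F t) (frontier (\<Omega> t))"
    and weld: "\<forall>\<^sub>F t in at_right 0. f (cis (\<psi> t)) t = F t (cis \<theta>)" and \<psi>: "(\<psi> \<longlongrightarrow> \<theta>) (at_right 0)"
  shows "((\<lambda>t. (\<psi> t - \<theta>) / t) \<longlongrightarrow> 2 * Im (p (cis \<theta>) 0)) (at_right 0)"
proof -
  have zero_mem: "0 \<in> {0..<T}" using T_pos by simp
  have "\<forall>t\<in>{0..<T}. \<exists>L. L \<in> disc_algebra \<and> Im (L 0) = 0 \<and>
      (\<forall>z. cmod z = 1 \<longrightarrow> F t z = z * exp (cnj (L z)))"
    using exterior_logarithm[OF _ F] by (intro ballI) metis
  then obtain L where L_disc: "\<And>t. t \<in> {0..<T} \<Longrightarrow> L t \<in> disc_algebra"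
      "\<And>t. t \<in> {0..<T} \<Longrightarrow> Im (L t 0) = 0"
    and F_eq: "\<And>t z. t \<in> {0..<T} \<Longrightarrow> cmod z = 1 \<Longrightarrow> F t z = z * exp (cnj (L t z))"
    unfolding bchoice_iff by blast
  have small: "\<forall>\<^sub>F t in at_right 0. 0 < t \<and> t < T \<and> M * t < 1/512"
    by (rule eventually_time_small) simp
  then have welding: "\<forall>\<^sub>F t in at_right 0. welding (boundary_log t) (L t) ((16 * M) * t)"
    by eventually_elim (auto intro!: welding_boundary_log F L_disc F_eq)
  have "uniform_limit (cball 0 1) (\<lambda>t z. L t z / of_real t) (\<lambda>z. - p z 0) (at_right 0)"
    using boundary_log_uniform_limit p_0[OF zero_mem]
      disc_algebra_mult[OF disc_algebra_const p_disc_algebra[OF zero_mem], of "-1"]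
    by (intro welding_uniform_limit[OF welding, where M = M]) (simp_all add: p_lipschitz[OF zero_mem])
  then have L_limit: "((\<lambda>t. L t (cis \<theta>) / of_real t) \<longlongrightarrow> - p (cis \<theta>) 0) (at_right 0)"
    by (rule tendsto_uniform_limitI) simp
  have q_limit: "((\<lambda>t. boundary_log t (cis (\<psi> t)) / of_real t) \<longlongrightarrow> - p (cis \<theta>) 0) (at_right 0)"
    by (rule boundary_log_tendsto[OF \<psi>])
  have "\<forall>\<^sub>F t in at_right 0. dist (\<psi> t) \<theta> < 1"
    by (rule tendstoD[OF \<psi>]) simp
  with weld small welding
  have "\<forall>\<^sub>F t in at_right 0.
      Im (cnj (L t (cis \<theta>) / of_real t) - boundary_log t (cis (\<psi> t)) / of_real t) = (\<psi> t - \<theta>) / t"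
    by eventually_elim (intro welded_angle_quotient, auto simp: dist_real_def F_eq)
  moreover have "((\<lambda>t. Im (cnj (L t (cis \<theta>) / of_real t) - boundary_log t (cis (\<psi> t)) / of_real t)) \<longlongrightarrow>
      Im (cnj (- p (cis \<theta>) 0) - (- p (cis \<theta>) 0))) (at_right 0)"
    by (intro tendsto_intros L_limit q_limit)
  ultimately show ?thesis
    using Lim_transform_eventually by fastforce
qed

end

theorem theorem1:
  fixes p f :: "complex \<Rightarrow> real \<Rightarrow> complex"
    and F :: "real \<Rightarrow> complex \<Rightarrow> complex"
    and T :: real
  assumes T_pos: "T > 0"
    and carath: "\<forall>t\<in>{0..<T}. caratheodory (\<lambda>z. p z t)"
    and p_C2: "\<forall>t\<in>{0..<T}. C2_closed_disc (\<lambda>z. p z t)"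
    and p_cont_t: "\<forall>z\<in>cball 0 1. continuous_on {0..<T} (p z)"
    and p_bdd: "\<exists>M. \<forall>t\<in>{0..<T}. (\<forall>z\<in>cball 0 1. norm (p z t) \<le> M) \<and>
                 (\<forall>z\<in>ball 0 1. norm (deriv (\<lambda>w. p w t) z) \<le> M \<and>
                                 norm (deriv (deriv (\<lambda>w. p w t)) z) \<le> M)"
    and f_conf: "\<forall>t\<in>{0..<T}. (\<lambda>z. f z t) holomorphic_on ball 0 1 \<and>
                   inj_on (\<lambda>z. f z t) (ball 0 1) \<and>
                   (\<lambda>z. f z t) ` ball 0 1 \<subseteq> ball 0 1 \<and>
                   f 0 t = 0 \<and> deriv (\<lambda>z. f z t) 0 = of_real (exp (- t))"
    and LK: "\<forall>z\<in>ball 0 1. \<forall>t\<in>{0..<T}.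
               ((\<lambda>s. f z s) has_vector_derivative (- z * deriv (\<lambda>w. f w t) z * p z t))
                 (at t within {0..<T})"
    and f_init: "\<forall>z\<in>ball 0 1. f z 0 = z"
    and f_boundary: "\<forall>t\<in>{0..<T}. continuous_on (cball 0 1) (\<lambda>z. f z t)"
    and F_conf: "\<forall>t\<in>{0..<T}. F t holomorphic_on {z. 1 < norm z} \<and>
                   inj_on (F t) {z. 1 < norm z} \<and>
                   F t ` {z. 1 < norm z} = outside (frontier ((\<lambda>z. f z t) ` ball 0 1)) \<and>
                   (\<exists>c>0. ((\<lambda>z. F t z / z) \<longlongrightarrow> of_real c) at_infinity) \<and>
                   continuous_on {z. 1 \<le> norm z} (F t)"
  shows "\<forall>\<theta> \<psi>. (\<forall>\<^sub>F t in at_right 0. f (cis (\<psi> t)) t = F t (cis \<theta>)) \<and>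
                (\<psi> \<longlongrightarrow> \<theta>) (at_right 0) \<longrightarrow>
           ((\<lambda>t. (\<psi> t - \<theta> - 2 * Im (p (cis \<theta>) 0) * t) / t) \<longlongrightarrow> 0) (at_right 0)"
proof (intro allI impI, elim conjE)
  fix \<theta> :: real and \<psi> :: "real \<Rightarrow> real"
  assume welded: "\<forall>\<^sub>F t in at_right 0. f (cis (\<psi> t)) t = F t (cis \<theta>)" and \<psi>: "(\<psi> \<longlongrightarrow> \<theta>) (at_right 0)"
  obtain M where "\<And>t z. t \<in> {0..<T} \<Longrightarrow> z \<in> cball 0 1 \<Longrightarrow> cmod (p z t) \<le> M"
    "\<And>t z. t \<in> {0..<T} \<Longrightarrow> z \<in> ball 0 1 \<Longrightarrow> cmod (deriv (\<lambda>w. p w t) z) \<le> M"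
    using p_bdd by blast
  then interpret Loewner_Kufarev p f T M
    using T_pos carath p_C2 p_cont_t f_conf LK f_init f_boundary
    by unfold_locales (auto simp: caratheodory_def C2_closed_disc_def disc_algebra_def image_subset_iff)
  have F: "exterior_conformal_map (F t) (frontier ((\<lambda>z. f z t) ` ball 0 1))" if "t \<in> {0..<T}" for t
    using F_conf that unfolding exterior_conformal_map_def by blast
  have "((\<lambda>t. (\<psi> t - \<theta>) / t - 2 * Im (p (cis \<theta>) 0)) \<longlongrightarrow> 0) (at_right 0)"
    by (rule LIM_zero[OF welding_first_order[OF F welded \<psi>]])
  moreover have "\<forall>\<^sub>F t in at_right 0. (\<psi> t - \<theta>) / t - 2 * Im (p (cis \<theta>) 0) =
      (\<psi> t - \<theta> - 2 * Im (p (cis \<theta>) 0) * t) / t"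
    using eventually_at_right_less[of 0] by eventually_elim (simp add: field_simps)
  ultimately show "((\<lambda>t. (\<psi> t - \<theta> - 2 * Im (p (cis \<theta>) 0) * t) / t) \<longlongrightarrow> 0) (at_right 0)"
    by (rule Lim_transform_eventually)
qed

end
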